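(* Let $0\neq f\in\mathfrak A_{m,r}$ be a pure function of type $\operatorname{type}(f)$, let $i\in\{1,\dots,m-1\}$ and let $\mu$ be a nontrivial character. Then $\mathfrak C_i^\mu(f)$ is pure if and only if (in additive notation) $$\mu=\partial_i(\operatorname{type}(f))-h,\qquad\text{where }\ \partial_i(\operatorname{type}(f))=\frac{\operatorname{type}(f)-s_i\operatorname{type}(f)}{x_i-x_{i+1}}.$$
   Context: For $\operatorname{Im}\tau>0$, $q=e^{2\pi i\tau}$, put $\theta_\tau(x)=2q^{1/8}\sin(\pi x)\prod_{n\ge1}(1-q^n)(1-q^ne^{2\pi i x})(1-q^ne^{-2\pi i x})$, $F_\tau(x,y)=\frac{\theta_\tau'(0)\theta_\tau(x+y)}{\theta_\tau(x)\theta_\tau(y)}$, and let $\delta=\delta_\tau$ be the function on $\mathbb C^*\times\mathbb C^*$ with $\delta(e^{2\pi i x},e^{2\pi i y})=F_\tau(x,y)$. Variables in $\mathbb C^*$: $u=x_0,x_1,\dots,x_m$ and $h=\mu_0,\mu_1,\dots,\mu_r$. $\mathfrak A_{m,r}$ is the algebra generated by the meromorphic functions $\delta(\ell_1,\ell_2)$, where $\ell_1$ is a nontrivial Laurent monomial in $u,x_1,\dots,x_m$ and $\ell_2$ a nontrivial Laurent monomial in $h,\mu_1,\dots,\mu_r$. Types: in arguments of $\delta$ variables are written multiplicatively, in quadratic forms additively (a Laurent monomial becomes an integral linear form). The theta function $\theta(\ell)$ of an integral linear combination $\ell$ of variables has type $\tfrac12\ell^2$; types add under products and subtract under quotients; in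 particular $\operatorname{type}(\delta(\ell_1,\ell_2))=\ell_1\ell_2$. A Laurent polynomial in such theta functions is pure if all its summands have the same type, and this common quadratic form is its type. Elements of $\mathfrak A_{m,r}$ that are pure have types that are linear in the $x$-variables ($u,x_1,\dots,x_m$) and linear in the $\mu$-variables ($h,\mu_1,\dots,\mu_r$). For a nontrivial character $\mu$ (a Laurent monomial in $h,\mu_1,\dots,\mu_r$, written additively as an integral linear form when compared with quadratic forms), $\mathfrak C_i^\mu(f)=\delta(\tfrac{x_{i+1}}{x_i},\mu)f+\delta(\tfrac{x_i}{x_{i+1}},h)s_if$, where $s_i$ exchanges $x_i$ and $x_{i+1}$ (in functions and in quadratic forms). *)

theory Defs
  imports "HOL-Analysis.Analysis" "HOL-Combinatorics.Transposition"
begin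

definition nome :: "complex \<Rightarrow> complex" where
  "nome \<tau> = exp (2 * of_real pi * \<i> * \<tau>)"

text \<open>The factor \<open>q^(1/8)\<close> means \<open>exp (2 \<pi> i \<tau> / 8)\<close>; the infinite product is indexed by \<open>n + 1\<close>.\<close>

definition theta :: "complex \<Rightarrow> complex \<Rightarrow> complex" where
  "theta \<tau> x = 2 * exp (2 * of_real pi * \<i> * \<tau> / 8) * sin (of_real pi * x) *
     prodinf (\<lambda>n. (1 - nome \<tau> ^ Suc n)
       * (1 - nome \<tau> ^ Suc n * exp (2 * of_real pi * \<i> * x))
       * (1 - nome \<tau> ^ Suc n * exp (- (2 * of_real pi * \<i> * x))))"

definition kronF :: "complex \<Rightarrow> complex \<Rightarrow> complex \<Rightarrow> complex" where
  "kronF \<tau> x y = deriv (theta \<tau>) 0 * theta \<tau> (x + y) / (theta \<tau> x * theta \<tau> y)"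

text \<open>\<open>kronF\<close> has period 1 in both variables, so any branch of the logarithm may be used to
  descend to the torus; the lemma \<open>delta_exp\<close> is the defining property.\<close>

definition delta :: "complex \<Rightarrow> complex \<Rightarrow> complex \<Rightarrow> complex" where
  "delta \<tau> a b = kronF \<tau> (Ln a / (2 * of_real pi * \<i>)) (Ln b / (2 * of_real pi * \<i>))"

lemma theta_plus_1: "theta \<tau> (x + 1) = - theta \<tau> x"
proof -
  have "exp (2 * of_real pi * \<i> * (x + 1)) = exp (2 * of_real pi * \<i> * x)"
    by (simp add: distrib_left exp_add)
  moreover have "exp (- (2 * of_real pi * \<i> * (x + 1))) = exp (- (2 * of_real pi * \<i> * x))"
    by (simp add: distrib_left exp_add exp_diff exp_minus)
  moreover have "sin (of_real pi * (x + 1)) = - sin (of_real pi * x)"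
    by (simp add: distrib_left sin_add)
  ultimately show ?thesis
    by (simp add: theta_def)
qed

lemma kronF_plus_1: "kronF \<tau> (x + 1) y = kronF \<tau> x y"
  using theta_plus_1[of \<tau> x] theta_plus_1[of \<tau> "x + y"]
  by (simp add: kronF_def add.assoc add.commute[of 1] add.left_commute)

lemma kronF_commute: "kronF \<tau> x y = kronF \<tau> y x"
  by (simp add: kronF_def add.commute mult.commute)

lemma kronF_plus_int: "kronF \<tau> (x + of_int k) y = kronF \<tau> x y"
proof (induction k rule: int_induct[where k = 0])
  case (step1 i)
  then show ?case
    using kronF_plus_1[of \<tau> "x + of_int i" y] by (simp add: add.assoc)
next
  case (step2 i)
  then show ?case
    using kronF_plus_1[of \<tau> "x + of_int (i - 1)" y] by (simp add: add.assoc)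
qed simp

lemma Ln_exp_two_pi_i:
  obtains k :: int where "Ln (exp (2 * of_real pi * \<i> * x)) / (2 * of_real pi * \<i>) = x + of_int k"
proof -
  have "exp (Ln (exp (2 * of_real pi * \<i> * x))) = exp (2 * of_real pi * \<i> * x)"
    by simp
  then obtain k :: int
    where "Ln (exp (2 * of_real pi * \<i> * x)) = 2 * of_real pi * \<i> * x + of_int (2 * k) * of_real pi * \<i>"
    unfolding exp_eq by auto
  then have "Ln (exp (2 * of_real pi * \<i> * x)) / (2 * of_real pi * \<i>) = x + of_int k"
    by (simp add: field_simps)
  then show ?thesis by (rule that)
qed

lemma delta_exp:
  "delta \<tau> (exp (2 * of_real pi * \<i> * x)) (exp (2 * of_real pi * \<i> * y)) = kronF \<tau> x y"
proof -
  obtain k l :: int where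
    "Ln (exp (2 * of_real pi * \<i> * x)) / (2 * of_real pi * \<i>) = x + of_int k"
    "Ln (exp (2 * of_real pi * \<i> * y)) / (2 * of_real pi * \<i>) = y + of_int l"
    by (metis Ln_exp_two_pi_i)
  then show ?thesis
    unfolding delta_def by (metis kronF_plus_int kronF_commute)
qed

text \<open>\<open>X 0\<close> is \<open>u\<close> and \<open>Mu 0\<close> is \<open>h\<close>.\<close>

datatype var = X nat | Mu nat

definition xvars :: "nat \<Rightarrow> var set" where
  "xvars m = X ` {0..m}"

definition muvars :: "nat \<Rightarrow> var set" where
  "muvars r = Mu ` {0..r}"

definition vars :: "nat \<Rightarrow> nat \<Rightarrow> var set" where
  "vars m r = xvars m \<union> muvars r"

text \<open>A Laurent monomial, equivalently an integral linear form, is given by its vector of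
  exponents. \<open>forms S\<close> consists of the nontrivial ones involving only the variables in \<open>S\<close>.\<close>

definition forms :: "var set \<Rightarrow> (var \<Rightarrow> int) set" where
  "forms S = {l. (\<forall>v. v \<notin> S \<longrightarrow> l v = 0) \<and> l \<noteq> (\<lambda>_. 0)}"

definition monomial_at :: "nat \<Rightarrow> nat \<Rightarrow> (var \<Rightarrow> int) \<Rightarrow> (var \<Rightarrow> complex) \<Rightarrow> complex" where
  "monomial_at m r l z = (\<Prod>v\<in>vars m r. z v powi l v)"

definition form_at :: "nat \<Rightarrow> nat \<Rightarrow> (var \<Rightarrow> int) \<Rightarrow> (var \<Rightarrow> complex) \<Rightarrow> complex" where
  "form_at m r l a = (\<Sum>v\<in>vars m r. of_int (l v) * a v)"

text \<open>Points of the torus and of its universal cover are extensional functions on the finite set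
  of variables.\<close>

definition torus_top :: "nat \<Rightarrow> nat \<Rightarrow> (var \<Rightarrow> complex) topology" where
  "torus_top m r = product_topology (\<lambda>_. top_of_set (- {0})) (vars m r)"

definition affine_top :: "nat \<Rightarrow> nat \<Rightarrow> (var \<Rightarrow> complex) topology" where
  "affine_top m r = product_topology (\<lambda>_. euclidean) (vars m r)"

text \<open>Meromorphic functions are represented by total functions, whose values on the polar locus
  are irrelevant. Two meromorphic functions are equal iff they agree on an open dense subset.\<close>

definition generic_eq ::
    "(var \<Rightarrow> complex) topology \<Rightarrow> ((var \<Rightarrow> complex) \<Rightarrow> complex) \<Rightarrow> ((var \<Rightarrow> complex) \<Rightarrow> complex) \<Rightarrow> bool"
  where
  "generic_eq T f g \<longleftrightarrow>
     (\<exists>U. openin T U \<and> T closure_of U = topspace T \<and> (\<forall>z\<in>U. f z = g z))"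

text \<open>The complex unital algebra generated by the \<open>\<delta>(l\<^sub>1, l\<^sub>2)\<close>. The rule \<open>cong\<close>
  closes it under change of representative.\<close>

inductive_set alg_A :: "complex \<Rightarrow> nat \<Rightarrow> nat \<Rightarrow> ((var \<Rightarrow> complex) \<Rightarrow> complex) set"
  for \<tau> m r where
  gen: "l1 \<in> forms (xvars m) \<Longrightarrow> l2 \<in> forms (muvars r) \<Longrightarrow>
     (\<lambda>z. delta \<tau> (monomial_at m r l1 z) (monomial_at m r l2 z)) \<in> alg_A \<tau> m r"
| const: "(\<lambda>_. c) \<in> alg_A \<tau> m r"
| add: "f \<in> alg_A \<tau> m r \<Longrightarrow> g \<in> alg_A \<tau> m r \<Longrightarrow> (\<lambda>z. f z + g z) \<in> alg_A \<tau> m r"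
| mult: "f \<in> alg_A \<tau> m r \<Longrightarrow> g \<in> alg_A \<tau> m r \<Longrightarrow> (\<lambda>z. f z * g z) \<in> alg_A \<tau> m r"
| cong: "f \<in> alg_A \<tau> m r \<Longrightarrow> generic_eq (torus_top m r) f g \<Longrightarrow> g \<in> alg_A \<tau> m r"

text \<open>A type is a quadratic form in the variables, represented as a polynomial function.
  A Laurent monomial in theta functions is \<open>\<Prod>\<^sub>l \<theta>(l)\<^bsup>e l\<^esup>\<close> over a finite set of forms \<open>l\<close>
  with integer exponents; its type is \<open>\<Sum>\<^sub>l e l \<cdot> l\<^sup>2 / 2\<close>.\<close>

definition theta_monomial ::
    "complex \<Rightarrow> nat \<Rightarrow> nat \<Rightarrow> (var \<Rightarrow> int) set \<Rightarrow> ((var \<Rightarrow> int) \<Rightarrow> int) \<Rightarrow> (var \<Rightarrow> complex) \<Rightarrow> complex"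
  where
  "theta_monomial \<tau> m r L e w = (\<Prod>l\<in>L. theta \<tau> (form_at m r l w) powi e l)"

definition theta_monomial_type ::
    "nat \<Rightarrow> nat \<Rightarrow> (var \<Rightarrow> int) set \<Rightarrow> ((var \<Rightarrow> int) \<Rightarrow> int) \<Rightarrow> (var \<Rightarrow> complex) \<Rightarrow> complex"
  where
  "theta_monomial_type m r L e a = (\<Sum>l\<in>L. of_int (e l) * ((form_at m r l a)\<^sup>2 / 2))"

text \<open>The coordinates of a point of the torus are exponentials; \<open>\<theta>\<close> itself changes sign
  under \<open>x \<mapsto> x + 1\<close>, so that Laurent polynomials in theta functions live on the universal cover.\<close>

definition exp_cover :: "nat \<Rightarrow> nat \<Rightarrow> (var \<Rightarrow> complex) \<Rightarrow> (var \<Rightarrow> complex)" where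
  "exp_cover m r w = restrict (\<lambda>v. exp (2 * of_real pi * \<i> * w v)) (vars m r)"

definition pure_of_type ::
    "complex \<Rightarrow> nat \<Rightarrow> nat \<Rightarrow> ((var \<Rightarrow> complex) \<Rightarrow> complex) \<Rightarrow> ((var \<Rightarrow> complex) \<Rightarrow> complex) \<Rightarrow> bool"
  where
  "pure_of_type \<tau> m r f Q \<longleftrightarrow>
     (\<exists>(N::nat) c L e. finite L \<and> L \<subseteq> forms (vars m r) \<and>
        (\<forall>k<N. theta_monomial_type m r L (e k) = Q) \<and>
        generic_eq (affine_top m r)
          (\<lambda>w. f (exp_cover m r w))
          (\<lambda>w. \<Sum>k<N. c k * theta_monomial \<tau> m r L (e k) w))"

definition pure :: "complex \<Rightarrow> nat \<Rightarrow> nat \<Rightarrow> ((var \<Rightarrow> complex) \<Rightarrow> complex) \<Rightarrow> bool" where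
  "pure \<tau> m r f \<longleftrightarrow> (\<exists>Q. pure_of_type \<tau> m r f Q)"

text \<open>The exchange of \<open>x\<^sub>i\<close> and \<open>x\<^bsub>i+1\<^esub>\<close>, both in functions on the torus and in
  quadratic forms.\<close>

definition swap_vars :: "nat \<Rightarrow> ((var \<Rightarrow> complex) \<Rightarrow> complex) \<Rightarrow> (var \<Rightarrow> complex) \<Rightarrow> complex" where
  "swap_vars i f z = f (z \<circ> Transposition.transpose (X i) (X (Suc i)))"

definition C_op ::
    "complex \<Rightarrow> nat \<Rightarrow> nat \<Rightarrow> nat \<Rightarrow> (var \<Rightarrow> int) \<Rightarrow> ((var \<Rightarrow> complex) \<Rightarrow> complex) \<Rightarrow> (var \<Rightarrow> complex) \<Rightarrow> complex"
  where
  "C_op \<tau> m r i \<mu> f z =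
     delta \<tau> (z (X (Suc i)) / z (X i)) (monomial_at m r \<mu> z) * f z
   + delta \<tau> (z (X i) / z (X (Suc i))) (z (Mu 0)) * swap_vars i f z"

text \<open>As a rational function; meaningful where \<open>a (X i) \<noteq> a (X (Suc i))\<close>.\<close>

definition divided_diff :: "nat \<Rightarrow> ((var \<Rightarrow> complex) \<Rightarrow> complex) \<Rightarrow> (var \<Rightarrow> complex) \<Rightarrow> complex" where
  "divided_diff i Q a = (Q a - swap_vars i Q a) / (a (X i) - a (X (Suc i)))"

end

theory Submission
  imports Defs "HOL-Complex_Analysis.Complex_Analysis" "HOL-Real_Asymp.Real_Asymp"
begin

text \<open>Equality of meromorphic functions is only generic here: representatives are total, with
  arbitrary values on an exceptional set. The independence argument, however, evaluates one identity
  at the countably many points w + 2 k \<tau> b, which may all miss a given open dense set. This is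
  why all functions are treated as theta sums over one finite set L of forms. Multiplied by a power
  of the product of the thetas of L, such a sum becomes entire along complex lines, so a generic
  identity holds at every point where no theta of L vanishes; that locus is stable under the shifts.
  The factor at k b also has a part linear in k that depends on w, but the quadratic part dominates
  it, so a single base point w at which both summands are nonzero suffices. The zero function is
  pure of every type, so the type assumed for the sum carries information only where the sum does
  not vanish. When the types of the two summands differ, the type of the sum can agree with at most
  one of them, and the coefficient of the other then has to vanish, a contradiction.\<close>

text \<open>A Laurent polynomial in theta functions of type \<open>Q\<close> is multiplied by an exponential factor
  determined by \<open>Q\<close> when its argument is shifted by an integral vector times \<open>2\<tau>\<close>. Along the
  multiples \<open>k b\<close> of an integral vector \<open>b\<close>, the modulus of this factor grows like
  \<open>exp (8 \<pi> Im(\<tau>) Q(b) k\<^sup>2)\<close>; choosing \<open>b\<close> such that finitely many given types take distinct values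
  at \<open>b\<close> shows that nonzero functions of distinct types are linearly independent. The two summands of
  \<open>C_op\<close> are nonzero of types \<open>Q + (x\<^bsub>i+1\<^esub> - x\<^sub>i) \<mu>\<close> and \<open>s\<^sub>i Q + (x\<^sub>i - x\<^bsub>i+1\<^esub>) h\<close>,
  so their sum is pure iff these two forms agree.\<close>

section \<open>Theta functions\<close>

text \<open>The q-Pochhammer symbol (y; q)_infinity. Starting at n = 0 makes the substitution of q y
  for y remove exactly one factor (\<open>qprod_rec\<close>); the products in \<open>theta\<close>,
  which start at q^1, are values at multiples of q.\<close>

definition qprod :: "complex \<Rightarrow> complex \<Rightarrow> complex" where
  "qprod q y = (\<Prod>n. 1 - q ^ n * y)"

lemma convergent_qprod:
  fixes q y :: complex
  assumes "norm q < 1"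
  shows "convergent_prod (\<lambda>n. 1 - q ^ n * y)"
proof -
  have "summable (\<lambda>n. norm q ^ n * norm y)"
    using assms by (intro summable_mult2 summable_geometric) simp
  then have "summable (\<lambda>n. norm ((1 - q ^ n * y) - 1))"
    by (simp add: norm_mult norm_power)
  then show ?thesis
    by (metis abs_convergent_prod_conv_summable abs_convergent_prod_imp_convergent_prod)
qed

lemma qprod_LIMSEQ:
  assumes "norm q < 1"
  shows "(\<lambda>N. \<Prod>n<N. 1 - q ^ n * y) \<longlonglongrightarrow> qprod q y"
  using convergent_prod_LIMSEQ[OF convergent_qprod[OF assms, of y]] LIMSEQ_lessThan_iff_atMost
  unfolding qprod_def by blast

lemma qprod_rec:
  assumes "norm q < 1"
  shows "qprod q y = (1 - y) * qprod q (q * y)"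
proof (rule LIMSEQ_unique)
  show "(\<lambda>N. \<Prod>n<Suc N. 1 - q ^ n * y) \<longlonglongrightarrow> qprod q y"
    using qprod_LIMSEQ[OF assms] by (rule LIMSEQ_Suc)
  have "(\<Prod>n<Suc N. 1 - q ^ n * y) = (1 - y) * (\<Prod>n<N. 1 - q ^ n * (q * y))" for N
    unfolding prod.lessThan_Suc_shift by (simp add: mult_ac)
  then show "(\<lambda>N. \<Prod>n<Suc N. 1 - q ^ n * y) \<longlonglongrightarrow> (1 - y) * qprod q (q * y)"
    using tendsto_mult_left[OF qprod_LIMSEQ[OF assms, of "q * y"], of "1 - y"] by simp
qed

lemma qprod_nonzero:
  assumes "norm q < 1" "norm y < 1"
  shows "qprod q y \<noteq> 0"
  unfolding qprod_def
proof (rule prodinf_nonzero[OF convergent_qprod[OF assms(1)]])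
  fix n
  have "norm (q ^ n * y) \<le> 1 * norm y"
    using assms unfolding norm_mult norm_power by (intro mult_right_mono power_le_one) auto
  then show "1 - q ^ n * y \<noteq> 0"
    using assms(2) by force
qed

text \<open>On the closed unit disc around x the terms q^n y are dominated by the geometric series
  |q|^n (|x| + 1), so the partial products converge locally uniformly.\<close>

lemma holomorphic_qprod:
  assumes "norm q < 1"
  shows "qprod q holomorphic_on S"
proof -
  have "qprod q holomorphic_on UNIV"
  proof (rule holomorphic_uniform_sequence)
    fix x :: complex
    have "uniformly_convergent_on (cball x 1) (\<lambda>N y. \<Prod>n<N. 1 - q ^ n * y)"
    proof (rule uniformly_convergent_on_prod')
      show "uniformly_convergent_on (cball x 1) (\<lambda>N y. \<Sum>n<N. norm (1 - q ^ n * y - 1))"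
      proof (rule Weierstrass_m_test')
        fix n y assume "y \<in> cball x 1"
        then have "norm y \<le> norm x + 1"
          using norm_triangle_ineq2[of y x] by (simp add: dist_norm norm_minus_commute)
        then show "norm (norm (1 - q ^ n * y - 1)) \<le> norm q ^ n * (norm x + 1)"
          by (simp add: norm_mult norm_power mult_left_mono)
      next
        show "summable (\<lambda>n. norm q ^ n * (norm x + 1))"
          using assms by (intro summable_mult2 summable_geometric) simp
      qed
    qed (auto intro!: continuous_intros)
    then obtain g where g: "uniform_limit (cball x 1) (\<lambda>N y. \<Prod>n<N. 1 - q ^ n * y) g sequentially"
      by (auto simp: uniformly_convergent_on_def)
    have "g y = qprod q y" if "y \<in> cball x 1" for y
      using LIMSEQ_unique[OF tendsto_uniform_limitI[OF g that] qprod_LIMSEQ[OF assms]] .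
    then have "uniform_limit (cball x 1) (\<lambda>N y. \<Prod>n<N. 1 - q ^ n * y) (qprod q) sequentially"
      using g by (metis (mono_tags, lifting) uniform_limit_cong')
    then show "\<exists>d>0. cball x d \<subseteq> UNIV \<and>
        uniform_limit (cball x d) (\<lambda>N y. \<Prod>n<N. 1 - q ^ n * y) (qprod q) sequentially"
      by (intro exI[of _ 1]) auto
  qed (auto intro!: holomorphic_intros)
  then show ?thesis
    using holomorphic_on_subset by blast
qed

section \<open>Theta as a product of q-Pochhammer symbols: nonvanishing and
  quasi-periodicity\<close>

lemma norm_nome_less_1: "Im \<tau> > 0 \<Longrightarrow> norm (nome \<tau>) < 1"
  by (simp add: nome_def)

lemma theta_eq_qprod:
  assumes "Im \<tau> > 0"
  shows "theta \<tau> x = 2 * exp (2 * of_real pi * \<i> * \<tau> / 8) * sin (of_real pi * x) *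
    (qprod (nome \<tau>) (nome \<tau>) * qprod (nome \<tau>) (nome \<tau> * exp (2 * of_real pi * \<i> * x)) *
     qprod (nome \<tau>) (nome \<tau> * exp (- (2 * of_real pi * \<i> * x))))"
proof -
  note conv = convergent_qprod[OF norm_nome_less_1[OF assms]]
  show ?thesis
    unfolding theta_def qprod_def
    unfolding prodinf_mult[OF conv conv] prodinf_mult[OF convergent_prod_mult[OF conv conv] conv]
    by (simp add: mult_ac)
qed

lemma holomorphic_theta [holomorphic_intros]:
  assumes "Im \<tau> > 0" "g holomorphic_on S"
  shows "(\<lambda>x. theta \<tau> (g x)) holomorphic_on S"
proof -
  note hol = holomorphic_on_compose_gen[OF _ holomorphic_qprod[OF norm_nome_less_1[OF assms(1)], of UNIV],
      unfolded o_def]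
  have "theta \<tau> holomorphic_on UNIV"
    unfolding theta_eq_qprod[OF assms(1), abs_def]
    by (intro holomorphic_intros hol) auto
  then show ?thesis
    using holomorphic_on_compose_gen[OF assms(2), of "theta \<tau>" UNIV] by (simp add: o_def)
qed

text \<open>Theta is the sine times a holomorphic P, so at 0 the product rule leaves only the
  derivative of the sine times P(0), the cube of a nonzero product. This derivative is the numerator
  constant of \<open>kronF\<close>.\<close>

lemma deriv_theta_0_nonzero:
  assumes "Im \<tau> > 0"
  shows "deriv (theta \<tau>) 0 \<noteq> 0"
proof -
  define q where "q = nome \<tau>"
  define P where "P x = qprod q q * qprod q (q * exp (2 * of_real pi * \<i> * x)) *
     qprod q (q * exp (- (2 * of_real pi * \<i> * x)))" for x
  define c where "c = 2 * exp (2 * of_real pi * \<i> * \<tau> / 8)"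
  have q: "norm q < 1"
    using norm_nome_less_1[OF assms] by (simp add: q_def)
  note hol = holomorphic_on_compose_gen[OF _ holomorphic_qprod[OF q, of UNIV], unfolded o_def]
  have "P holomorphic_on UNIV"
    unfolding P_def by (intro holomorphic_intros hol) auto
  then have P: "(P has_field_derivative deriv P 0) (at 0)"
    by (intro holomorphic_derivI[of _ UNIV]) auto
  have "((\<lambda>x. c * sin (of_real pi * x) * P x) has_field_derivative c * of_real pi * P 0) (at 0)"
    by (rule derivative_eq_intros P refl | simp)+
  moreover have "theta \<tau> = (\<lambda>x. c * sin (of_real pi * x) * P x)"
    by (simp add: theta_eq_qprod[OF assms] P_def c_def q_def fun_eq_iff)
  ultimately have "deriv (theta \<tau>) 0 = c * of_real pi * P 0"
    by (simp add: DERIV_imp_deriv)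
  also have "\<dots> \<noteq> 0"
    using qprod_nonzero[OF q q] by (simp add: c_def P_def)
  finally show ?thesis .
qed

text \<open>One explicit nonzero value, which shows that theta of a nontrivial form does not vanish
  identically. At 1/2 the sine is 1 and the exponentials are -1, so the remaining factors are values
  of \<open>qprod\<close> at q and -q.\<close>

lemma theta_half_nonzero:
  assumes "Im \<tau> > 0"
  shows "theta \<tau> (1 / 2) \<noteq> 0"
proof -
  have q: "norm (nome \<tau>) < 1"
    using norm_nome_less_1[OF assms] .
  have "sin (of_real pi * (1 / 2)) = (1 :: complex)"
    using sin_of_real[of "pi / 2", where 'a = complex] by simp
  moreover have "exp (2 * of_real pi * \<i> * (1 / 2)) = (- 1 :: complex)"
    by (simp add: mult.commute)
  moreover have "exp (- (2 * of_real pi * \<i> * (1 / 2))) = (- 1 :: complex)"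
    by (simp add: mult.commute exp_minus)
  ultimately show ?thesis
    using qprod_nonzero[OF q q] qprod_nonzero[OF q, of "- nome \<tau>"] q
    by (simp add: theta_eq_qprod[OF assms])
qed

text \<open>The shift by \<tau> multiplies e^(2 pi i x) by q: one infinite product loses its first
  factor and the other gains one. These two factors and the two sines combine to the
  exponential.\<close>

lemma theta_plus_tau:
  assumes "Im \<tau> > 0"
  shows "theta \<tau> (x + \<tau>) = - exp (- (of_real pi * \<i> * (\<tau> + 2 * x))) * theta \<tau> x"
proof -
  define q where "q = nome \<tau>"
  \<comment> \<open>With the square root s x of e^(2 pi i x), the sine, the arguments of
    \<open>qprod\<close> and q itself are all rational in s x and s \<tau>, so the claim reduces to
    an identity of rational functions.\<close>
  define s where "s x = exp (of_real pi * \<i> * x)" for x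
  define c where "c = 2 * exp (2 * of_real pi * \<i> * \<tau> / 8) * qprod q q"
  have q: "norm q < 1"
    using norm_nome_less_1[OF assms] by (simp add: q_def)
  have "q \<noteq> 0" and nz: "s y \<noteq> 0" for y
    by (auto simp: q_def s_def nome_def)
  have sadd: "s (a + b) = s a * s b" for a b
    by (simp add: s_def distrib_left exp_add)
  have qs: "q = s \<tau> ^ 2"
    by (simp add: q_def nome_def s_def mult_ac flip: exp_of_nat_mult)
  have sin: "sin (of_real pi * y) = (s y - 1 / s y) / (2 * \<i>)" for y
    by (simp add: sin_exp_eq s_def exp_minus field_simps)
  have th: "theta \<tau> y = c * ((s y - 1 / s y) / (2 * \<i>)) * qprod q (q * s y ^ 2) * qprod q (q / s y ^ 2)" for y
  proof -
    have "exp (2 * of_real pi * \<i> * y) = s y ^ 2"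
      by (simp add: s_def mult_ac flip: exp_of_nat_mult)
    moreover from this have "exp (- (2 * of_real pi * \<i> * y)) = 1 / s y ^ 2"
      by (simp add: exp_minus divide_inverse)
    ultimately show ?thesis
      unfolding theta_eq_qprod[OF assms] sin q_def[symmetric] by (simp add: c_def)
  qed
  have 1: "qprod q (q * s x ^ 2) = (1 - q * s x ^ 2) * qprod q (q * (q * s x ^ 2))"
    by (rule qprod_rec[OF q])
  have 2: "qprod q (1 / s x ^ 2) = (1 - 1 / s x ^ 2) * qprod q (q / s x ^ 2)"
    using qprod_rec[OF q, of "1 / s x ^ 2"] by simp
  have "theta \<tau> (x + \<tau>) = c * ((s x * s \<tau> - 1 / (s x * s \<tau>)) / (2 * \<i>)) *
      qprod q (q * (q * s x ^ 2)) * ((1 - 1 / s x ^ 2) * qprod q (q / s x ^ 2))"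
    unfolding th sadd 2[symmetric]
    using \<open>q \<noteq> 0\<close> by (simp add: qs power_mult_distrib mult_ac)
  also have "\<dots> = c / (2 * \<i>) * qprod q (q * (q * s x ^ 2)) * qprod q (q / s x ^ 2) *
      ((s x * s \<tau> - 1 / (s x * s \<tau>)) * (1 - 1 / s x ^ 2))"
    by simp
  also have "(s x * s \<tau> - 1 / (s x * s \<tau>)) * (1 - 1 / s x ^ 2) =
      - (1 / (s \<tau> * s x ^ 2)) * ((s x - 1 / s x) * (1 - q * s x ^ 2))"
    unfolding qs using nz[of x] nz[of \<tau>] by (simp add: field_simps power2_eq_square)
  also have "c / (2 * \<i>) * qprod q (q * (q * s x ^ 2)) * qprod q (q / s x ^ 2) * \<dots> =
      - (1 / (s \<tau> * s x ^ 2)) * theta \<tau> x"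
    unfolding th 1 by (simp add: mult_ac)
  also have "1 / (s \<tau> * s x ^ 2) = exp (- (of_real pi * \<i> * (\<tau> + 2 * x)))"
    by (simp add: s_def exp_minus exp_diff distrib_left exp_add divide_inverse mult_ac flip: exp_of_nat_mult)
  finally show ?thesis by simp
qed

text \<open>The shift n will be the value of a form at an integral vector, which may be negative;
  the downward induction step solves the law \<open>step\<close> for theta at the lower
  point.\<close>

lemma theta_plus_2_tau_int:
  assumes "Im \<tau> > 0"
  shows "theta \<tau> (x + 2 * of_int n * \<tau>) =
    exp (- (4 * of_real pi * \<i> * (\<tau> * of_int n ^ 2 + of_int n * x))) * theta \<tau> x"
proof -
  have step: "theta \<tau> (y + 2 * \<tau>) = exp (- (4 * of_real pi * \<i> * (\<tau> + y))) * theta \<tau> y" for y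
  proof -
    have "theta \<tau> (y + \<tau> + \<tau>) = exp (- (of_real pi * \<i> * (\<tau> + 2 * (y + \<tau>))))
        * exp (- (of_real pi * \<i> * (\<tau> + 2 * y))) * theta \<tau> y"
      unfolding theta_plus_tau[OF assms, of "y + \<tau>"] theta_plus_tau[OF assms, of y] by simp
    then have "theta \<tau> (y + \<tau> + \<tau>) = exp (- (of_real pi * \<i> * (\<tau> + 2 * (y + \<tau>))) +
        - (of_real pi * \<i> * (\<tau> + 2 * y))) * theta \<tau> y"
      by (simp only: exp_add)
    also have "y + \<tau> + \<tau> = y + 2 * \<tau>"
      by simp
    finally show ?thesis
      by (simp add: algebra_simps)
  qed
  show ?thesis
  proof (induction n rule: int_induct[where k = 0])
    case (step1 n)
    have "theta \<tau> (x + 2 * of_int (n + 1) * \<tau>) = theta \<tau> ((x + 2 * of_int n * \<tau>) + 2 * \<tau>)"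
      by (simp add: algebra_simps)
    then show ?case
      unfolding step step1 by (simp add: algebra_simps power2_eq_square flip: exp_add)
  next
    case (step2 n)
    define w where "w = x + 2 * of_int (n - 1) * \<tau>"
    have "theta \<tau> (x + 2 * of_int n * \<tau>) = theta \<tau> (w + 2 * \<tau>)"
      by (simp add: algebra_simps w_def)
    then have "exp (- (4 * of_real pi * \<i> * (\<tau> + w))) * theta \<tau> w =
        exp (- (4 * of_real pi * \<i> * (\<tau> * of_int n ^ 2 + of_int n * x))) * theta \<tau> x"
      using step2 by (simp add: step)
    then have "theta \<tau> w = exp (4 * of_real pi * \<i> * (\<tau> + w)) *
        (exp (- (4 * of_real pi * \<i> * (\<tau> * of_int n ^ 2 + of_int n * x))) * theta \<tau> x)"
      by (metis (no_types, lifting) exp_minus_inverse mult.assoc mult_1)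
    then show ?case
      unfolding w_def by (simp add: algebra_simps power2_eq_square flip: exp_add)
  qed simp
qed

section \<open>Generic equality and functions that are entire along lines\<close>

definition open_dense :: "'a topology \<Rightarrow> 'a set \<Rightarrow> bool" where
  "open_dense T U \<longleftrightarrow> openin T U \<and> T closure_of U = topspace T"

lemma generic_eq_iff_open_dense: "generic_eq T f g \<longleftrightarrow> (\<exists>U. open_dense T U \<and> (\<forall>z\<in>U. f z = g z))"
  by (auto simp: generic_eq_def open_dense_def)

lemma open_dense_iff:
  "open_dense T U \<longleftrightarrow> openin T U \<and> (\<forall>V. openin T V \<and> V \<noteq> {} \<longrightarrow> U \<inter> V \<noteq> {})"
  by (simp add: open_dense_def dense_intersects_open)

lemma open_dense_topspace: "open_dense T (topspace T)"
  by (simp add: open_dense_def)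

lemma open_dense_Int:
  assumes "open_dense T U" "open_dense T V"
  shows "open_dense T (U \<inter> V)"
  using assms unfolding open_dense_iff by (metis inf_assoc openin_Int)

lemma generic_eq_trans:
  assumes "generic_eq T f g" "generic_eq T g h"
  shows "generic_eq T f h"
proof -
  obtain U V where "open_dense T U" "\<forall>z\<in>U. f z = g z" "open_dense T V" "\<forall>z\<in>V. g z = h z"
    using assms by (auto simp: generic_eq_iff_open_dense)
  then show ?thesis
    unfolding generic_eq_iff_open_dense by (intro exI[of _ "U \<inter> V"]) (simp add: open_dense_Int)
qed

lemma generic_eq_sym: "generic_eq T f g \<Longrightarrow> generic_eq T g f"
  by (force simp: generic_eq_def)

lemma topspace_affine: "topspace (affine_top m r) = PiE (vars m r) (\<lambda>_. UNIV)"
  by (simp add: affine_top_def)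

lemma finite_vars [simp]: "finite (vars m r)"
  by (simp add: vars_def xvars_def muvars_def)

lemma restrict_in_affine [simp]: "restrict w (vars m r) \<in> topspace (affine_top m r)"
  by (simp add: topspace_affine)

lemma form_at_cong: "(\<And>v. v \<in> vars m r \<Longrightarrow> a v = b v) \<Longrightarrow> form_at m r l a = form_at m r l b"
  by (simp add: form_at_def)

lemma form_at_restrict [simp]: "form_at m r l (restrict w (vars m r)) = form_at m r l w"
  by (rule form_at_cong) simp

text \<open>A substitute for holomorphy in several variables that supports the identity theorem.
  Continuity makes the nonvanishing set open. The last condition is there because points of
  \<open>affine_top\<close> are extensional, while lines are taken among all functions on the
  variables.\<close>

definition line_entire :: "nat \<Rightarrow> nat \<Rightarrow> ((var \<Rightarrow> complex) \<Rightarrow> complex) \<Rightarrow> bool" where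
  "line_entire m r G \<longleftrightarrow>
     (\<forall>w v. (\<lambda>t. G (\<lambda>x. w x + t * v x)) holomorphic_on UNIV) \<and>
     continuous_map (affine_top m r) euclidean G \<and>
     (\<forall>w. G (restrict w (vars m r)) = G w)"

lemma line_entire_const: "line_entire m r (\<lambda>_. c)"
  by (simp add: line_entire_def)

lemma line_entire_add:
  "line_entire m r F \<Longrightarrow> line_entire m r G \<Longrightarrow> line_entire m r (\<lambda>w. F w + G w)"
  unfolding line_entire_def by (auto intro!: holomorphic_intros continuous_map_add)

lemma continuous_map_times:
  fixes f g :: "'a \<Rightarrow> complex"
  assumes "continuous_map T euclidean f" "continuous_map T euclidean g"
  shows "continuous_map T euclidean (\<lambda>x. f x * g x)"
  using assms by (simp add: continuous_map_atin tendsto_mult)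

lemma line_entire_mult:
  "line_entire m r F \<Longrightarrow> line_entire m r G \<Longrightarrow> line_entire m r (\<lambda>w. F w * G w)"
  unfolding line_entire_def by (auto intro!: holomorphic_intros continuous_map_times)

lemma line_entire_power: "line_entire m r F \<Longrightarrow> line_entire m r (\<lambda>w. F w ^ n)"
  by (induction n) (auto intro: line_entire_const line_entire_mult)

lemma line_entire_sum: "(\<And>k. k \<in> K \<Longrightarrow> line_entire m r (F k)) \<Longrightarrow> line_entire m r (\<lambda>w. \<Sum>k\<in>K. F k w)"
  by (induction K rule: infinite_finite_induct) (auto intro: line_entire_const line_entire_add)

lemma line_entire_prod: "(\<And>k. k \<in> K \<Longrightarrow> line_entire m r (F k)) \<Longrightarrow> line_entire m r (\<lambda>w. \<Prod>k\<in>K. F k w)"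
  by (induction K rule: infinite_finite_induct) (auto intro: line_entire_const line_entire_mult)

lemma form_at_line: "form_at m r l (\<lambda>x. w x + t * v x) = form_at m r l w + t * form_at m r l v"
  by (simp add: form_at_def algebra_simps sum.distrib sum_distrib_left)

lemma line_entire_theta:
  assumes "Im \<tau> > 0"
  shows "line_entire m r (\<lambda>w. theta \<tau> (form_at m r l w))"
  unfolding line_entire_def form_at_line
proof (intro conjI allI)
  have "continuous_map (affine_top m r) euclidean (form_at m r l)"
    unfolding form_at_def [abs_def] affine_top_def
    by (intro continuous_map_sum continuous_map_times)
       (auto intro: continuous_map_product_projection[where X = "\<lambda>_. euclidean", simplified])
  moreover have "continuous_on UNIV (theta \<tau>)"
    using holomorphic_theta[OF assms holomorphic_on_ident] holomorphic_on_imp_continuous_on by blast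
  ultimately show "continuous_map (affine_top m r) euclidean (\<lambda>w. theta \<tau> (form_at m r l w))"
    using continuous_map_compose[of "affine_top m r" euclidean "form_at m r l" euclidean "theta \<tau>"]
    by (simp add: o_def)
qed (auto intro!: holomorphic_intros assms)

text \<open>If G vanished on a nonempty open V, then along the complex line from a point of V to
  \<open>w0\<close> the identity theorem in one variable would make it vanish at \<open>w0\<close>
  too.\<close>

lemma line_entire_nonzero_open_dense:
  assumes G: "line_entire m r G" and "G w0 \<noteq> 0"
  shows "open_dense (affine_top m r) {w \<in> topspace (affine_top m r). G w \<noteq> 0}"
  unfolding open_dense_iff
proof (intro conjI allI impI)
  let ?T = "affine_top m r"
  have "openin ?T {w \<in> topspace ?T. G w \<in> - {0}}"
    using G openin_continuous_map_preimage[of ?T euclidean G "- {0}"] by (auto simp: line_entire_def)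
  then show "openin ?T {w \<in> topspace ?T. G w \<noteq> 0}"
    by simp
  fix V assume V: "openin ?T V \<and> V \<noteq> {}"
  then obtain w1 where w1: "w1 \<in> V"
    by blast
  \<comment> \<open>The line passes through \<open>w1\<close> at t = 0 and \<open>w0\<close> at t =
    1. Its points need not be extensional, so \<open>\<gamma>\<close> restricts them; G takes the
    same values on both.\<close>
  define p where "p t = (\<lambda>x. w1 x + t * (w0 x - w1 x))" for t
  define \<gamma> where "\<gamma> t = restrict (p t) (vars m r)" for t
  have G\<gamma>: "G (\<gamma> t) = G (p t)" for t
    using G by (simp add: line_entire_def \<gamma>_def)
  have "continuous_map euclidean ?T \<gamma>"
    unfolding affine_top_def continuous_map_componentwise
    by (auto simp: \<gamma>_def p_def intro!: continuous_intros)
  then have "openin euclidean {t \<in> topspace euclidean. \<gamma> t \<in> V}"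
    using V openin_continuous_map_preimage by blast
  then have opn: "open {t. \<gamma> t \<in> V}"
    by simp
  have "w1 \<in> topspace ?T"
    using V w1 openin_subset by blast
  then have "\<gamma> 0 = w1"
    by (simp add: \<gamma>_def p_def topspace_affine)
  then have ne: "{t. \<gamma> t \<in> V} \<noteq> {}"
    using w1 by auto
  have "p 1 = w0"
    by (simp add: p_def)
  have hol: "(\<lambda>t. G (p t)) holomorphic_on UNIV"
    using G by (simp add: line_entire_def p_def)
  have "\<exists>t. \<gamma> t \<in> V \<and> G (p t) \<noteq> 0"
  proof (rule ccontr)
    assume "\<nexists>t. \<gamma> t \<in> V \<and> G (p t) \<noteq> 0"
    then have "G (p 1) = 0"
      by (intro analytic_continuation_open[OF opn open_UNIV ne connected_UNIV _ hol holomorphic_on_const, where z = 1])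
         auto
    then show False
      using \<open>p 1 = w0\<close> assms(2) by simp
  qed
  then show "{w \<in> topspace ?T. G w \<noteq> 0} \<inter> V \<noteq> {}"
    using V openin_subset[of ?T V] unfolding G\<gamma>[symmetric] by blast
qed

lemma open_dense_affine_nonempty:
  assumes "open_dense (affine_top m r) U"
  obtains w where "w \<in> U"
proof -
  have "topspace (affine_top m r) \<noteq> {}"
    using restrict_in_affine by blast
  then show thesis
    using assms that unfolding open_dense_def by (metis closure_of_empty ex_in_conv)
qed

text \<open>Where no theta of L vanishes, negative powers have their intended value. Unlike a
  general open dense set, this locus is stable under \<open>shift\<close>
  (\<open>regular_shift\<close>).\<close>

definition regular :: "complex \<Rightarrow> nat \<Rightarrow> nat \<Rightarrow> (var \<Rightarrow> int) set \<Rightarrow> (var \<Rightarrow> complex) \<Rightarrow> bool" where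
  "regular \<tau> m r L w \<longleftrightarrow> (\<forall>l\<in>L. theta \<tau> (form_at m r l w) \<noteq> 0)"

lemma theta_form_nonzero:
  assumes "Im \<tau> > 0" "l \<in> forms (vars m r)"
  obtains w where "theta \<tau> (form_at m r l w) \<noteq> 0"
proof -
  obtain v where v: "l v \<noteq> 0" "v \<in> vars m r"
    using assms(2) by (auto simp: forms_def fun_eq_iff)
  \<comment> \<open>A multiple of a coordinate vector at which the form takes the value 1/2, a known
    nonzero of theta.\<close>
  define w where "w = (\<lambda>u. if u = v then 1 / (2 * of_int (l v)) else 0 :: complex)"
  have "form_at m r l w = (\<Sum>u\<in>vars m r. if u = v then 1 / 2 else 0)"
    unfolding form_at_def w_def using v by (intro sum.cong) auto
  also have "\<dots> = 1 / 2"
    using v by simp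
  finally show thesis
    using theta_half_nonzero[OF assms(1)] that by metis
qed

lemma regular_open_dense:
  assumes "Im \<tau> > 0" "finite L" "L \<subseteq> forms (vars m r)"
  shows "open_dense (affine_top m r) {w \<in> topspace (affine_top m r). regular \<tau> m r L w}"
  using assms(2,3)
proof (induction L rule: finite_induct)
  case empty
  then show ?case
    by (simp add: regular_def open_dense_topspace)
next
  case (insert l L)
  obtain w where "theta \<tau> (form_at m r l w) \<noteq> 0"
    using theta_form_nonzero[OF assms(1)] insert.prems by blast
  from line_entire_nonzero_open_dense[of m r "\<lambda>w. theta \<tau> (form_at m r l w)", OF line_entire_theta[OF assms(1)] this]
  have "open_dense (affine_top m r)
      ({w \<in> topspace (affine_top m r). theta \<tau> (form_at m r l w) \<noteq> 0} \<inter>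
       {w \<in> topspace (affine_top m r). regular \<tau> m r L w})"
    using insert by (intro open_dense_Int) auto
  moreover have "\<dots> = {w \<in> topspace (affine_top m r). regular \<tau> m r (insert l L) w}"
    by (auto simp: regular_def)
  ultimately show ?case
    by simp
qed

text \<open>The sum represents \<open>F\<close> only where no theta function vanishes: elsewhere negative powers have
  the junk value \<open>0\<close> and exponents do not add under multiplication.\<close>

definition theta_sum ::
  "complex \<Rightarrow> nat \<Rightarrow> nat \<Rightarrow> (var \<Rightarrow> int) set \<Rightarrow> ((var \<Rightarrow> complex) \<Rightarrow> complex) \<Rightarrow> ((var \<Rightarrow> complex) \<Rightarrow> complex) \<Rightarrow> bool"
  where
  "theta_sum \<tau> m r L Q F \<longleftrightarrow>
     (\<exists>(N::nat) c e. (\<forall>k<N. theta_monomial_type m r L (e k) = Q) \<and>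
        (\<forall>w. regular \<tau> m r L w \<longrightarrow> F w = (\<Sum>k<N. c k * theta_monomial \<tau> m r L (e k) w)))"

text \<open>Agreement with the explicit sum on the regular locus is enough because that locus is
  open and dense. The gain is a function F that can be multiplied by \<open>kronF\<close>, whatever
  its values elsewhere.\<close>

lemma pure_of_type_iff_theta_sum:
  assumes "Im \<tau> > 0"
  shows "pure_of_type \<tau> m r f Q \<longleftrightarrow>
    (\<exists>L F. finite L \<and> L \<subseteq> forms (vars m r) \<and> theta_sum \<tau> m r L Q F \<and>
       generic_eq (affine_top m r) (\<lambda>w. f (exp_cover m r w)) F)"
proof
  assume "pure_of_type \<tau> m r f Q"
  then obtain N c L e where L: "finite L" "L \<subseteq> forms (vars m r)"
    and type: "\<forall>k<(N::nat). theta_monomial_type m r L (e k) = Q"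
    and gen: "generic_eq (affine_top m r) (\<lambda>w. f (exp_cover m r w))
      (\<lambda>w. \<Sum>k<N. c k * theta_monomial \<tau> m r L (e k) w)"
    unfolding pure_of_type_def by blast
  have "theta_sum \<tau> m r L Q (\<lambda>w. \<Sum>k<N. c k * theta_monomial \<tau> m r L (e k) w)"
    unfolding theta_sum_def using type by (intro exI[of _ N] exI[of _ c] exI[of _ e]) simp
  with L gen show "\<exists>L F. finite L \<and> L \<subseteq> forms (vars m r) \<and> theta_sum \<tau> m r L Q F \<and>
       generic_eq (affine_top m r) (\<lambda>w. f (exp_cover m r w)) F"
    by (intro exI conjI)
next
  assume "\<exists>L F. finite L \<and> L \<subseteq> forms (vars m r) \<and> theta_sum \<tau> m r L Q F \<and>
       generic_eq (affine_top m r) (\<lambda>w. f (exp_cover m r w)) F"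
  then obtain L F N c e where L: "finite L" "L \<subseteq> forms (vars m r)"
    and gen: "generic_eq (affine_top m r) (\<lambda>w. f (exp_cover m r w)) F"
    and type: "\<forall>k<(N::nat). theta_monomial_type m r L (e k) = Q"
    and F: "\<forall>w. regular \<tau> m r L w \<longrightarrow> F w = (\<Sum>k<N. c k * theta_monomial \<tau> m r L (e k) w)"
    unfolding theta_sum_def by blast
  have "generic_eq (affine_top m r) F (\<lambda>w. \<Sum>k<N. c k * theta_monomial \<tau> m r L (e k) w)"
    unfolding generic_eq_iff_open_dense
    using regular_open_dense[OF assms L] F by (intro exI conjI) auto
  from generic_eq_trans[OF gen this] show "pure_of_type \<tau> m r f Q"
    unfolding pure_of_type_def using L type by (intro exI conjI)
qed

lemma regular_mono: "L \<subseteq> L' \<Longrightarrow> regular \<tau> m r L' w \<Longrightarrow> regular \<tau> m r L w"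
  by (auto simp: regular_def)

text \<open>Exponents are extended by 0, so that sums over different sets of forms can be compared
  over a common one.\<close>

lemma theta_sum_mono:
  assumes "theta_sum \<tau> m r L Q F" "L \<subseteq> L'" "finite L'"
  shows "theta_sum \<tau> m r L' Q F"
proof -
  obtain N c e where type: "\<forall>k<(N::nat). theta_monomial_type m r L (e k) = Q"
    and F: "\<forall>w. regular \<tau> m r L w \<longrightarrow> F w = (\<Sum>k<N. c k * theta_monomial \<tau> m r L (e k) w)"
    using assms(1) unfolding theta_sum_def by blast
  define e' where "e' k l = (if l \<in> L then e k l else 0)" for k l
  have "theta_monomial_type m r L' (e' k) = theta_monomial_type m r L (e k)" for k
    unfolding theta_monomial_type_def e'_def
    by (intro ext sum.mono_neutral_cong_right assms) auto
  moreover have "theta_monomial \<tau> m r L' (e' k) = theta_monomial \<tau> m r L (e k)" for k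
    unfolding theta_monomial_def e'_def
    by (intro ext prod.mono_neutral_cong_right assms) auto
  ultimately show ?thesis
    unfolding theta_sum_def using type F regular_mono[OF assms(2)]
    by (intro exI[of _ N] exI[of _ c] exI[of _ e']) auto
qed

lemma theta_sum_add:
  assumes "theta_sum \<tau> m r L Q F" "theta_sum \<tau> m r L Q G"
  shows "theta_sum \<tau> m r L Q (\<lambda>w. F w + G w)"
proof -
  obtain N c e where type: "\<forall>k<(N::nat). theta_monomial_type m r L (e k) = Q"
    and F: "\<forall>w. regular \<tau> m r L w \<longrightarrow> F w = (\<Sum>k<N. c k * theta_monomial \<tau> m r L (e k) w)"
    using assms(1) unfolding theta_sum_def by blast
  obtain N' c' e' where type': "\<forall>k<(N'::nat). theta_monomial_type m r L (e' k) = Q"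
    and G: "\<forall>w. regular \<tau> m r L w \<longrightarrow> G w = (\<Sum>k<N'. c' k * theta_monomial \<tau> m r L (e' k) w)"
    using assms(2) unfolding theta_sum_def by blast
  define cc where "cc k = (if k < N then c k else c' (k - N))" for k
  define ee where "ee k = (if k < N then e k else e' (k - N))" for k
  have split: "(\<Sum>k<N + n. h k) = (\<Sum>k<N. h k) + (\<Sum>k<n. h (N + k))" for h :: "nat \<Rightarrow> complex" and n
    by (induction n) (simp_all add: add.assoc)
  show ?thesis
    unfolding theta_sum_def using type type' F G
    by (intro exI[of _ "N + N'"] exI[of _ cc] exI[of _ ee])
       (auto simp: split cc_def ee_def)
qed

lemma theta_sum_cmult:
  assumes "theta_sum \<tau> m r L Q F"
  shows "theta_sum \<tau> m r L Q (\<lambda>w. a * F w)"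
proof -
  obtain N c e where "\<forall>k<(N::nat). theta_monomial_type m r L (e k) = Q"
    and "\<forall>w. regular \<tau> m r L w \<longrightarrow> F w = (\<Sum>k<N. c k * theta_monomial \<tau> m r L (e k) w)"
    using assms(1) unfolding theta_sum_def by blast
  then show ?thesis
    unfolding theta_sum_def
    by (intro exI[of _ N] exI[of _ "\<lambda>k. a * c k"] exI[of _ e]) (auto simp: sum_distrib_left mult.assoc)
qed

lemma theta_sum_theta_powi:
  assumes "theta_sum \<tau> m r L Q F" "finite L" "l \<in> L"
  shows "theta_sum \<tau> m r L (\<lambda>a. Q a + of_int d * ((form_at m r l a)\<^sup>2 / 2))
    (\<lambda>w. theta \<tau> (form_at m r l w) powi d * F w)"
proof -
  obtain N c e where type: "\<forall>k<(N::nat). theta_monomial_type m r L (e k) = Q"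
    and F: "\<forall>w. regular \<tau> m r L w \<longrightarrow> F w = (\<Sum>k<N. c k * theta_monomial \<tau> m r L (e k) w)"
    using assms(1) unfolding theta_sum_def by blast
  define e' where "e' k = (e k)(l := e k l + d)" for k
  have "theta_monomial_type m r L (e' k) a = theta_monomial_type m r L (e k) a + of_int d * ((form_at m r l a)\<^sup>2 / 2)"
    for k a
    unfolding theta_monomial_type_def sum.remove[OF assms(2,3)] e'_def by (simp add: algebra_simps add_divide_distrib)
  moreover have "theta_monomial \<tau> m r L (e' k) w = theta \<tau> (form_at m r l w) powi d * theta_monomial \<tau> m r L (e k) w"
    if "regular \<tau> m r L w" for k w
    using that assms(3) unfolding theta_monomial_def prod.remove[OF assms(2,3)] e'_def regular_def
    by (simp add: power_int_add)
  ultimately show ?thesis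
    unfolding theta_sum_def using type F
    by (intro exI[of _ N] exI[of _ c] exI[of _ e']) (auto simp: sum_distrib_left mult_ac fun_eq_iff)
qed

lemma theta_sum_cong:
  assumes "theta_sum \<tau> m r L Q F" "\<And>w. regular \<tau> m r L w \<Longrightarrow> F w = G w"
  shows "theta_sum \<tau> m r L Q G"
  using assms unfolding theta_sum_def by metis

lemma form_at_add: "form_at m r (\<lambda>v. l1 v + l2 v) a = form_at m r l1 a + form_at m r l2 a"
  by (simp add: form_at_def algebra_simps sum.distrib)

lemma form_at_uminus: "form_at m r (\<lambda>v. - l v) a = - form_at m r l a"
  by (simp add: form_at_def sum_negf)

text \<open>Up to a constant, \<open>kronF\<close> is theta(l1 + l2) / (theta(l1) theta(l2)), and
  ((l1 + l2)^2 - l1^2 - l2^2) / 2 = l1 l2. Hence three applications of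
  \<open>theta_sum_theta_powi\<close>, with exponents 1, -1 and -1.\<close>

lemma theta_sum_kronF:
  assumes "theta_sum \<tau> m r L Q F" "finite L" "l1 \<in> L" "l2 \<in> L" "(\<lambda>v. l1 v + l2 v) \<in> L"
  shows "theta_sum \<tau> m r L (\<lambda>a. Q a + form_at m r l1 a * form_at m r l2 a)
    (\<lambda>w. kronF \<tau> (form_at m r l1 w) (form_at m r l2 w) * F w)"
proof -
  note step = theta_sum_theta_powi[OF _ assms(2)]
  note 1 = step[OF assms(1,5), of 1]
  note 2 = step[OF 1 assms(3), of "- 1"]
  note 3 = step[OF 2 assms(4), of "- 1"]
  show ?thesis
  proof (rule theta_sum_cong)
    show "theta_sum \<tau> m r L (\<lambda>a. Q a + form_at m r l1 a * form_at m r l2 a)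
      (\<lambda>w. deriv (theta \<tau>) 0 * (theta \<tau> (form_at m r l2 w) powi (- 1) * (theta \<tau> (form_at m r l1 w) powi (- 1) *
       (theta \<tau> (form_at m r (\<lambda>v. l1 v + l2 v) w) powi 1 * F w))))"
      using theta_sum_cmult[OF 3, of "deriv (theta \<tau>) 0"]
      by (simp add: form_at_add power2_sum add_divide_distrib)
  qed (simp add: form_at_add kronF_def divide_inverse mult_ac)
qed

section \<open>Quasi-periodicity and independence of types\<close>

text \<open>A common denominator, some power of the product of all thetas of L, turns F into a
  function to which the identity theorem applies.\<close>

definition clearable ::
  "complex \<Rightarrow> nat \<Rightarrow> nat \<Rightarrow> (var \<Rightarrow> int) set \<Rightarrow> ((var \<Rightarrow> complex) \<Rightarrow> complex) \<Rightarrow> bool" where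
  "clearable \<tau> m r L F \<longleftrightarrow> (\<exists>G n. line_entire m r G \<and>
     (\<forall>w. regular \<tau> m r L w \<longrightarrow> G w = (\<Prod>l\<in>L. theta \<tau> (form_at m r l w)) ^ n * F w))"

lemma line_entire_theta_prod:
  assumes "Im \<tau> > 0"
  shows "line_entire m r (\<lambda>w. (\<Prod>l\<in>L. theta \<tau> (form_at m r l w)) ^ n)"
  by (intro line_entire_power line_entire_prod line_entire_theta assms)

lemma clearable_theta_sum:
  assumes "Im \<tau> > 0" "theta_sum \<tau> m r L Q F" "finite L"
  shows "clearable \<tau> m r L F"
proof -
  obtain N c e where F: "\<forall>w. regular \<tau> m r L w \<longrightarrow> F w = (\<Sum>k<(N::nat). c k * theta_monomial \<tau> m r L (e k) w)"
    using assms(2) unfolding theta_sum_def by blast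
  \<comment> \<open>An upper bound for all |e k l|, so that every exponent e k l + M is nonnegative
    and \<open>nat\<close> loses nothing.\<close>
  define M where "M = (\<Sum>k<N. \<Sum>l\<in>L. nat \<bar>e k l\<bar>)"
  define G where "G w = (\<Sum>k<N. c k * (\<Prod>l\<in>L. theta \<tau> (form_at m r l w) ^ nat (e k l + int M)))" for w
  have M: "0 \<le> e k l + int M" if "k < N" "l \<in> L" for k l
  proof -
    have "nat \<bar>e k l\<bar> \<le> (\<Sum>l\<in>L. nat \<bar>e k l\<bar>)"
      using that assms(3) by (intro member_le_sum) auto
    also have "\<dots> \<le> M"
      unfolding M_def using that by (intro member_le_sum[where f = "\<lambda>k. \<Sum>l\<in>L. nat \<bar>e k l\<bar>"]) auto
    finally show ?thesis by linarith
  qed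
  have "line_entire m r G"
    unfolding G_def
    by (intro line_entire_sum line_entire_mult line_entire_const line_entire_prod line_entire_power
        line_entire_theta assms)
  moreover have "G w = (\<Prod>l\<in>L. theta \<tau> (form_at m r l w)) ^ M * F w" if w: "regular \<tau> m r L w" for w
  proof -
    have "(\<Prod>l\<in>L. theta \<tau> (form_at m r l w) ^ nat (e k l + int M)) =
        (\<Prod>l\<in>L. theta \<tau> (form_at m r l w)) ^ M * theta_monomial \<tau> m r L (e k) w" if "k < N" for k
      unfolding theta_monomial_def prod_power_distrib prod.distrib[symmetric]
    proof (intro prod.cong refl)
      fix l assume "l \<in> L"
      have "theta \<tau> (form_at m r l w) ^ nat (e k l + int M) = theta \<tau> (form_at m r l w) powi (int M + e k l)"
        using M[OF that \<open>l \<in> L\<close>] by (simp add: power_int_def add.commute)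
      then show "theta \<tau> (form_at m r l w) ^ nat (e k l + int M) =
          theta \<tau> (form_at m r l w) ^ M * theta \<tau> (form_at m r l w) powi e k l"
        using w \<open>l \<in> L\<close> by (simp add: regular_def power_int_add)
    qed
    then show ?thesis
      using F w unfolding G_def by (simp add: sum_distrib_left mult_ac)
  qed
  ultimately show ?thesis
    unfolding clearable_def by blast
qed

lemma clearable_add:
  assumes "Im \<tau> > 0" "clearable \<tau> m r L F" "clearable \<tau> m r L G"
  shows "clearable \<tau> m r L (\<lambda>w. F w + G w)"
proof -
  let ?D = "\<lambda>w. \<Prod>l\<in>L. theta \<tau> (form_at m r l w)"
  obtain F' k where F': "line_entire m r F'" "\<forall>w. regular \<tau> m r L w \<longrightarrow> F' w = ?D w ^ k * F w"
    using assms(2) unfolding clearable_def by blast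
  obtain G' n where G': "line_entire m r G'" "\<forall>w. regular \<tau> m r L w \<longrightarrow> G' w = ?D w ^ n * G w"
    using assms(3) unfolding clearable_def by blast
  have "line_entire m r (\<lambda>w. ?D w ^ n * F' w + ?D w ^ k * G' w)"
    by (intro line_entire_add line_entire_mult line_entire_theta_prod assms F' G')
  moreover have "?D w ^ n * F' w + ?D w ^ k * G' w = ?D w ^ (n + k) * (F w + G w)" if "regular \<tau> m r L w" for w
    using F' G' that by (simp add: power_add algebra_simps)
  ultimately show ?thesis
    unfolding clearable_def by (intro exI[of _ "\<lambda>w. ?D w ^ n * F' w + ?D w ^ k * G' w"] exI[of _ "n + k"]) simp
qed

text \<open>At regular points the denominator is nonzero, so F and its cleared numerator have the
  same zeros there, and the numerator is entire along lines.\<close>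

lemma clearable_nonzero_open_dense:
  assumes "Im \<tau> > 0" "finite L" "L \<subseteq> forms (vars m r)" "clearable \<tau> m r L F"
    and "regular \<tau> m r L w0" "F w0 \<noteq> 0"
  shows "open_dense (affine_top m r) {w \<in> topspace (affine_top m r). regular \<tau> m r L w \<and> F w \<noteq> 0}"
proof -
  let ?D = "\<lambda>w. \<Prod>l\<in>L. theta \<tau> (form_at m r l w)"
  obtain G n where G: "line_entire m r G" "\<And>w. regular \<tau> m r L w \<Longrightarrow> G w = ?D w ^ n * F w"
    using assms(4) unfolding clearable_def by blast
  have D: "?D w \<noteq> 0" if "regular \<tau> m r L w" for w
    using that assms(2) by (simp add: regular_def)
  then have "G w0 \<noteq> 0"
    using G(2) assms(5,6) by (metis mult_eq_0_iff power_not_zero)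
  then have "open_dense (affine_top m r)
      ({w \<in> topspace (affine_top m r). regular \<tau> m r L w} \<inter> {w \<in> topspace (affine_top m r). G w \<noteq> 0})"
    by (intro open_dense_Int regular_open_dense line_entire_nonzero_open_dense[OF G(1)] assms)
  moreover have "\<dots> = {w \<in> topspace (affine_top m r). regular \<tau> m r L w \<and> F w \<noteq> 0}"
    using G(2) D by auto
  ultimately show ?thesis by simp
qed

lemma clearable_not_generic_zero:
  assumes "Im \<tau> > 0" "finite L" "L \<subseteq> forms (vars m r)" "clearable \<tau> m r L F"
    and "\<not> generic_eq (affine_top m r) F (\<lambda>_. 0)"
  shows "open_dense (affine_top m r) {w \<in> topspace (affine_top m r). regular \<tau> m r L w \<and> F w \<noteq> 0}"
proof -
  obtain w where "regular \<tau> m r L w" "F w \<noteq> 0"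
    using assms(5) regular_open_dense[OF assms(1-3)] unfolding generic_eq_iff_open_dense by blast
  then show ?thesis
    by (rule clearable_nonzero_open_dense[OF assms(1-4)])
qed

text \<open>A single regular point with a nonzero value would give an open dense set of them, which
  meets the open dense set where F vanishes.\<close>

lemma clearable_generic_zero:
  assumes "Im \<tau> > 0" "finite L" "L \<subseteq> forms (vars m r)" "clearable \<tau> m r L F"
    and "generic_eq (affine_top m r) F (\<lambda>_. 0)" "regular \<tau> m r L w"
  shows "F w = 0"
proof (rule ccontr)
  assume "F w \<noteq> 0"
  obtain U where "open_dense (affine_top m r) U" "\<forall>z\<in>U. F z = 0"
    using assms(5) unfolding generic_eq_iff_open_dense by blast
  moreover from open_dense_Int[OF clearable_nonzero_open_dense[OF assms(1-4,6) \<open>F w \<noteq> 0\<close>] this(1)]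
  obtain z where "z \<in> U" "F z \<noteq> 0"
    using open_dense_affine_nonempty by blast
  ultimately show False by blast
qed

text \<open>For N = 0 the condition on the type is vacuous and Q may be any function whatsoever; a
  nonzero value forces a summand, and with it a genuine type.\<close>

lemma theta_sum_nonzero_type:
  assumes "theta_sum \<tau> m r L Q F" "regular \<tau> m r L w" "F w \<noteq> 0"
  obtains e where "Q = theta_monomial_type m r L e"
proof -
  obtain N c e where type: "\<forall>k<(N::nat). theta_monomial_type m r L (e k) = Q"
    and F: "F w = (\<Sum>k<N. c k * theta_monomial \<tau> m r L (e k) w)"
    using assms(1,2) unfolding theta_sum_def by blast
  then have "N \<noteq> 0"
    using assms(3) by (intro notI) simp
  then show thesis
    using that[of "e 0"] type by simp
qed

section \<open>Polarisation and the behaviour under integral shifts\<close>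

definition polar :: "((var \<Rightarrow> complex) \<Rightarrow> complex) \<Rightarrow> (var \<Rightarrow> complex) \<Rightarrow> (var \<Rightarrow> complex) \<Rightarrow> complex" where
  "polar Q a b = Q (\<lambda>v. a v + b v) - Q a - Q b"

lemma polar_theta_monomial_type:
  "polar (theta_monomial_type m r L e) a b = (\<Sum>l\<in>L. of_int (e l) * (form_at m r l a * form_at m r l b))"
proof -
  have "form_at m r l (\<lambda>v. a v + b v) = form_at m r l a + form_at m r l b" for l
    using form_at_line[of m r l a 1 b] by simp
  then show ?thesis
    unfolding polar_def theta_monomial_type_def sum_subtractf[symmetric]
    by (intro sum.cong) (auto simp: power2_sum field_simps)
qed

lemma form_at_scale: "form_at m r l (\<lambda>v. t * a v) = t * form_at m r l a"
  using form_at_line[of m r l "\<lambda>_. 0" t a] by (simp add: form_at_def)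

lemma theta_monomial_type_scale:
  "theta_monomial_type m r L e (\<lambda>v. t * a v) = t\<^sup>2 * theta_monomial_type m r L e a"
  by (simp add: theta_monomial_type_def form_at_scale power_mult_distrib sum_distrib_left mult_ac)

lemma polar_theta_monomial_type_scale:
  "polar (theta_monomial_type m r L e) (\<lambda>v. t * a v) b = t * polar (theta_monomial_type m r L e) a b"
  by (simp add: polar_theta_monomial_type form_at_scale sum_distrib_left mult_ac)

lemma theta_monomial_type_line:
  "theta_monomial_type m r L e (\<lambda>v. a v + t * b v) = theta_monomial_type m r L e a
     + polar (theta_monomial_type m r L e) b a * t + theta_monomial_type m r L e b * t\<^sup>2"
proof -
  have "polar (theta_monomial_type m r L e) (\<lambda>v. t * b v) a = theta_monomial_type m r L e (\<lambda>v. a v + t * b v)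
      - theta_monomial_type m r L e (\<lambda>v. t * b v) - theta_monomial_type m r L e a"
    by (simp add: polar_def add.commute)
  then show ?thesis
    unfolding polar_theta_monomial_type_scale theta_monomial_type_scale by (simp add: algebra_simps)
qed

text \<open>The factor 2 removes the sign in the quasi-periodicity of \<open>theta\<close>.\<close>

definition shift :: "complex \<Rightarrow> (var \<Rightarrow> int) \<Rightarrow> (var \<Rightarrow> complex) \<Rightarrow> var \<Rightarrow> complex" where
  "shift \<tau> b w = (\<lambda>v. w v + 2 * \<tau> * of_int (b v))"

lemma theta_form_shift:
  assumes "Im \<tau> > 0"
  shows "theta \<tau> (form_at m r l (shift \<tau> b w)) =
    exp (- (4 * of_real pi * \<i> * (\<tau> * form_at m r l (of_int \<circ> b) ^ 2
      + form_at m r l (of_int \<circ> b) * form_at m r l w))) * theta \<tau> (form_at m r l w)"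
proof -
  define n where "n = (\<Sum>v\<in>vars m r. l v * b v)"
  have n: "form_at m r l (of_int \<circ> b) = of_int n"
    by (simp add: form_at_def n_def)
  have "form_at m r l (shift \<tau> b w) = form_at m r l w + 2 * of_int n * \<tau>"
    using form_at_line[of m r l w "2 * \<tau>" "of_int \<circ> b"] n by (simp add: shift_def mult_ac)
  then show ?thesis
    using theta_plus_2_tau_int[OF assms, of "form_at m r l w" n] n by simp
qed

lemma regular_shift: "Im \<tau> > 0 \<Longrightarrow> regular \<tau> m r L w \<Longrightarrow> regular \<tau> m r L (shift \<tau> b w)"
  by (simp add: regular_def theta_form_shift)

text \<open>The factor of automorphy for type Q. By \<open>theta_form_shift\<close>, theta(l)
  contributes the exponent -4 pi i (\<tau> l(b)^2 + l(b) l(w)). Weighted with e l and summed, the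
  squares give 2 Q(b) and the mixed products give \<open>polar Q\<close> at (b, w), so only the type
  enters.\<close>

definition multiplier :: "complex \<Rightarrow> (var \<Rightarrow> complex) \<Rightarrow> (var \<Rightarrow> int) \<Rightarrow> ((var \<Rightarrow> complex) \<Rightarrow> complex) \<Rightarrow> complex" where
  "multiplier \<tau> w b Q = exp (- (4 * of_real pi * \<i> * (2 * \<tau> * Q (of_int \<circ> b) + polar Q (of_int \<circ> b) w)))"

lemma theta_monomial_shift:
  assumes "Im \<tau> > 0"
  shows "theta_monomial \<tau> m r L e (shift \<tau> b w) =
    multiplier \<tau> w b (theta_monomial_type m r L e) * theta_monomial \<tau> m r L e w"
proof (cases "finite L")
  case True
  let ?E = "\<lambda>l. of_int (e l) * - (4 * of_real pi * \<i> * (\<tau> * form_at m r l (of_int \<circ> b) ^ 2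
      + form_at m r l (of_int \<circ> b) * form_at m r l w))"
  have "theta_monomial \<tau> m r L e (shift \<tau> b w) = (\<Prod>l\<in>L. exp (?E l)) * theta_monomial \<tau> m r L e w"
    unfolding theta_monomial_def theta_form_shift[OF assms] power_int_mult_distrib exp_power_int prod.distrib ..
  also have "(\<Prod>l\<in>L. exp (?E l)) = exp (\<Sum>l\<in>L. ?E l)"
    using True by (simp add: exp_sum)
  also have "(\<Sum>l\<in>L. ?E l) = - (4 * of_real pi * \<i> * (2 * \<tau> * theta_monomial_type m r L e (of_int \<circ> b)
      + polar (theta_monomial_type m r L e) (of_int \<circ> b) w))"
    unfolding polar_theta_monomial_type theta_monomial_type_def sum_distrib_left sum.distrib[symmetric] sum_negf[symmetric]
    by (intro sum.cong) (simp_all add: algebra_simps)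
  finally show ?thesis
    by (simp add: multiplier_def)
next
  \<comment> \<open>Over an infinite L the sum is 0 and the product is 1 by convention, and both
    sides become 1.\<close>
  case False
  then have "theta_monomial_type m r L e = (\<lambda>_. 0)"
    by (simp add: theta_monomial_type_def fun_eq_iff)
  then show ?thesis
    using False by (simp add: theta_monomial_def multiplier_def polar_def)
qed

lemma theta_sum_shift:
  assumes "Im \<tau> > 0" "theta_sum \<tau> m r L Q F" "regular \<tau> m r L w"
  shows "F (shift \<tau> b w) = multiplier \<tau> w b Q * F w"
proof -
  obtain N c e where type: "\<forall>k<(N::nat). theta_monomial_type m r L (e k) = Q"
    and F: "\<forall>w. regular \<tau> m r L w \<longrightarrow> F w = (\<Sum>k<N. c k * theta_monomial \<tau> m r L (e k) w)"
    using assms(2) unfolding theta_sum_def by blast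
  then show ?thesis
    using assms regular_shift[OF assms(1,3)]
    by (simp add: theta_monomial_shift sum_distrib_left mult_ac)
qed

section \<open>Independence of exponentials of quadratic polynomials\<close>

lemma exp_quadratic_tendsto_0:
  assumes "Re p < 0"
  shows "(\<lambda>k::nat. exp (of_nat k ^ 2 * p + of_nat k * s)) \<longlonglongrightarrow> 0"
proof (rule tendsto_norm_zero_cancel)
  have "((\<lambda>k::nat. exp (real k ^ 2 * a + real k * c)) \<longlonglongrightarrow> 0)" if "a < 0" for a c :: real
    using that by real_asymp
  from this[OF assms, of "Re s"]
  show "(\<lambda>k::nat. norm (exp (of_nat k ^ 2 * p + of_nat k * s))) \<longlonglongrightarrow> 0"
    by (simp flip: of_nat_power)
qed

text \<open>After division by the exponential of index j, every other term tends to 0 whatever the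
  linear coefficients s are, while term j is the constant \<open>x j\<close>.\<close>

lemma exp_quadratic_dominant:
  fixes x p s :: "'a \<Rightarrow> complex"
  assumes "finite J" "j \<in> J" and dom: "\<And>i. i \<in> J \<Longrightarrow> i \<noteq> j \<Longrightarrow> Re (p i) < Re (p j)"
    and zero: "\<And>k::nat. (\<Sum>i\<in>J. x i * exp (of_nat k ^ 2 * p i + of_nat k * s i)) = 0"
  shows "x j = 0"
proof -
  let ?h = "\<lambda>i k. x i * exp (of_nat k ^ 2 * (p i - p j) + of_nat k * (s i - s j))"
  have split: "?h i k = x i * exp (of_nat k ^ 2 * p i + of_nat k * s i) * exp (- (of_nat k ^ 2 * p j + of_nat k * s j))" for i k
    by (simp add: algebra_simps flip: exp_add)
  have "(\<Sum>i\<in>J. ?h i k) = 0" for k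
    unfolding split sum_distrib_right[symmetric] zero by simp
  then have "x j = - (\<Sum>i\<in>J - {j}. ?h i k)" for k
    using sum.remove[OF assms(1,2), of "\<lambda>i. ?h i k"] by (simp add: eq_neg_iff_add_eq_0)
  moreover have "(\<lambda>k. - (\<Sum>i\<in>J - {j}. ?h i k)) \<longlonglongrightarrow> - (\<Sum>i\<in>J - {j}. x i * 0)"
    using dom by (intro tendsto_intros exp_quadratic_tendsto_0) auto
  ultimately have "(\<lambda>k::nat. x j) \<longlonglongrightarrow> 0"
    by simp
  then show ?thesis
    by (simp add: LIMSEQ_const_iff)
qed

text \<open>Among the indices with nonzero coefficient, the one with maximal real part of p is
  strictly dominant by injectivity, so its coefficient would be 0.\<close>

lemma exp_quadratic_independent:
  fixes x p s :: "'a \<Rightarrow> complex"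
  assumes "finite J" and inj: "inj_on (\<lambda>i. Re (p i)) J"
    and zero: "\<And>k::nat. (\<Sum>i\<in>J. x i * exp (of_nat k ^ 2 * p i + of_nat k * s i)) = 0"
  shows "\<forall>i\<in>J. x i = 0"
proof (rule ccontr)
  define J' where "J' = {i \<in> J. x i \<noteq> 0}"
  assume "\<not> (\<forall>i\<in>J. x i = 0)"
  then have J': "finite J'" "J' \<noteq> {}"
    using assms(1) by (auto simp: J'_def)
  then obtain j where j: "j \<in> J'" and max: "\<And>i. i \<in> J' \<Longrightarrow> Re (p i) \<le> Re (p j)"
    using obtains_MAX[of J' "\<lambda>i. Re (p i)"] by (metis (no_types, lifting) Max_ge finite_imageI imageI)
  have "Re (p i) < Re (p j)" if "i \<in> J'" "i \<noteq> j" for i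
    using max[OF that(1)] inj that j by (force simp: J'_def inj_on_def)
  moreover have "(\<Sum>i\<in>J'. x i * exp (of_nat k ^ 2 * p i + of_nat k * s i)) = 0" for k :: nat
    using zero[of k] sum.mono_neutral_right[OF assms(1), of J' "\<lambda>i. x i * exp (of_nat k ^ 2 * p i + of_nat k * s i)"]
    by (auto simp: J'_def)
  ultimately have "x j = 0"
    by (intro exp_quadratic_dominant[OF J'(1) j, of p x s]) auto
  then show False
    using j by (simp add: J'_def)
qed

section \<open>Integral vectors that separate finitely many types\<close>

lemma form_at_of_int_real: "form_at m r l (of_int \<circ> b) \<in> \<real>"
  by (simp add: form_at_def)

lemma theta_monomial_type_real: "theta_monomial_type m r L e (of_int \<circ> b) \<in> \<real>"
  unfolding theta_monomial_type_def
  by (intro sum_in_Reals Reals_mult Reals_divide Reals_power form_at_of_int_real) auto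

definition unit_form :: "var \<Rightarrow> var \<Rightarrow> int" where
  "unit_form u = (\<lambda>v. if v = u then 1 else 0)"

lemma form_at_of_unit: "u \<in> vars m r \<Longrightarrow> form_at m r l (of_int \<circ> unit_form u) = of_int (l u)"
  by (simp add: form_at_def unit_form_def if_distrib cong: if_cong)

lemma form_at_unit: "u \<in> vars m r \<Longrightarrow> form_at m r (unit_form u) a = a u"
  by (simp add: form_at_def unit_form_def if_distrib if_distribR cong: if_cong)

text \<open>A quadratic form is recovered from its Gram matrix. The unit vectors are integral, so
  its values at integral vectors determine it: e_u, e_v and e_u + e_v give all entries.\<close>

lemma theta_monomial_type_eq_polar_units:
  "theta_monomial_type m r L e a = (\<Sum>u\<in>vars m r. \<Sum>v\<in>vars m r.
     polar (theta_monomial_type m r L e) (of_int \<circ> unit_form u) (of_int \<circ> unit_form v) / 2 * (a u * a v))"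
proof -
  have square: "(form_at m r l a)\<^sup>2 = (\<Sum>u\<in>vars m r. \<Sum>v\<in>vars m r.
      of_int (l u) * a u * (of_int (l v) * a v))" for l
    unfolding form_at_def power2_eq_square sum_product ..
  have "theta_monomial_type m r L e a = (\<Sum>l\<in>L. \<Sum>u\<in>vars m r. \<Sum>v\<in>vars m r.
      of_int (e l) * (of_int (l u) * of_int (l v)) / 2 * (a u * a v))"
    unfolding theta_monomial_type_def square sum_divide_distrib sum_distrib_left
    by (intro sum.cong refl) simp
  also have "\<dots> = (\<Sum>u\<in>vars m r. \<Sum>v\<in>vars m r. \<Sum>l\<in>L.
      of_int (e l) * (of_int (l u) * of_int (l v)) / 2 * (a u * a v))"
    by (subst sum.swap, intro sum.cong refl, subst sum.swap) (rule refl)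
  also have "\<dots> = (\<Sum>u\<in>vars m r. \<Sum>v\<in>vars m r.
     polar (theta_monomial_type m r L e) (of_int \<circ> unit_form u) (of_int \<circ> unit_form v) / 2 * (a u * a v))"
    by (intro sum.cong refl)
       (simp add: polar_theta_monomial_type form_at_of_unit sum_distrib_right sum_divide_distrib)
  finally show ?thesis .
qed

lemma theta_monomial_type_nonzero_int:
  assumes "theta_monomial_type m r L e \<noteq> (\<lambda>_. 0)"
  obtains b where "theta_monomial_type m r L e (of_int \<circ> b) \<noteq> 0"
proof (rule ccontr)
  let ?Q = "theta_monomial_type m r L e"
  assume "\<not> thesis"
  then have zero: "?Q (of_int \<circ> b) = 0" for b
    using that by blast
  have "polar ?Q (of_int \<circ> a) (of_int \<circ> b) = 0" for a b
    using zero[of "\<lambda>v. a v + b v"] zero[of a] zero[of b] by (simp add: polar_def o_def)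
  then have "?Q = (\<lambda>_. 0)"
    by (intro ext, subst theta_monomial_type_eq_polar_units) simp
  then show False
    using assms by simp
qed

lemma finite_quadratic_roots_nat:
  fixes a b c :: complex
  assumes "a \<noteq> 0 \<or> c \<noteq> 0"
  shows "finite {k::nat. a + b * of_nat k + c * (of_nat k)\<^sup>2 = 0}"
proof -
  have "finite {z. poly [:a, b, c:] z = 0}"
    using assms by (intro poly_roots_finite) auto
  then have "finite (of_nat -` {z. poly [:a, b, c:] z = 0} :: nat set)"
    by (intro finite_vimageI inj_of_nat)
  moreover have "of_nat -` {z. poly [:a, b, c:] z = 0} = {k::nat. a + b * of_nat k + c * (of_nat k)\<^sup>2 = 0}"
    by (auto simp: algebra_simps power2_eq_square)
  ultimately show ?thesis
    by simp
qed

text \<open>The new vector is sought on the line b + k b'. Along it each type is a polynomial in k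
  of degree at most 2: for the old types the constant term is nonzero, for the new one the
  coefficient of k^2 is. So each excludes only finitely many k.\<close>

lemma theta_monomial_types_nonzero_int:
  assumes "finite E" "\<And>e. e \<in> E \<Longrightarrow> theta_monomial_type m r L e \<noteq> (\<lambda>_. 0)"
  shows "\<exists>b. \<forall>e\<in>E. theta_monomial_type m r L e (of_int \<circ> b) \<noteq> 0"
  using assms
proof (induction E rule: finite_induct)
  case (insert d E)
  have "\<exists>b. \<forall>e\<in>E. theta_monomial_type m r L e (of_int \<circ> b) \<noteq> 0"
    by (rule insert.IH, rule insert.prems) simp
  then obtain b where b: "\<And>e. e \<in> E \<Longrightarrow> theta_monomial_type m r L e (of_int \<circ> b) \<noteq> 0"
    by blast
  obtain b' where b': "theta_monomial_type m r L d (of_int \<circ> b') \<noteq> 0"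
    using theta_monomial_type_nonzero_int[of m r L d] insert.prems by blast
  define c where "c k = (\<lambda>v. b v + int k * b' v)" for k
  have c: "theta_monomial_type m r L e (of_int \<circ> c k) = theta_monomial_type m r L e (of_int \<circ> b)
      + polar (theta_monomial_type m r L e) (of_int \<circ> b') (of_int \<circ> b) * of_nat k
      + theta_monomial_type m r L e (of_int \<circ> b') * (of_nat k)\<^sup>2" for e k
    using theta_monomial_type_line[of m r L e "of_int \<circ> b" "of_nat k" "of_int \<circ> b'"]
    by (simp add: c_def o_def)
  have "finite {k. theta_monomial_type m r L e (of_int \<circ> c k) = 0}" if "e \<in> insert d E" for e
    unfolding c using that b b' by (intro finite_quadratic_roots_nat) auto
  then have "finite (\<Union>e\<in>insert d E. {k. theta_monomial_type m r L e (of_int \<circ> c k) = 0})"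
    using insert.hyps by blast
  then obtain k where "k \<notin> (\<Union>e\<in>insert d E. {k. theta_monomial_type m r L e (of_int \<circ> c k) = 0})"
    using ex_new_if_finite infinite_UNIV_nat by blast
  then show ?case
    by blast
qed simp

lemma theta_monomial_type_diff:
  "theta_monomial_type m r L (\<lambda>l. e l - d l) a = theta_monomial_type m r L e a - theta_monomial_type m r L d a"
  by (simp add: theta_monomial_type_def algebra_simps sum_subtractf diff_divide_distrib)

text \<open>With w fixed, the factors are independent as functions of b alone. It is enough to test
  them on the multiples of one integral vector that separates the types.\<close>

lemma multiplier_independent:
  assumes "Im \<tau> > 0" "finite \<Q>" "\<And>Q. Q \<in> \<Q> \<Longrightarrow> \<exists>e. Q = theta_monomial_type m r L e"
    and zero: "\<And>b. (\<Sum>Q\<in>\<Q>. x Q * multiplier \<tau> w b Q) = 0"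
  shows "\<forall>Q\<in>\<Q>. x Q = 0"
proof -
  obtain ex where ex: "\<And>Q. Q \<in> \<Q> \<Longrightarrow> Q = theta_monomial_type m r L (ex Q)"
    using assms(3) by metis
  \<comment> \<open>The difference of two types over L is again a type over L, with the differences
    of the exponents. A vector where all nonzero differences are nonzero therefore separates the
    types.\<close>
  define E where "E = (\<lambda>(Q, R) l. ex Q l - ex R l) ` {(Q, R). Q \<in> \<Q> \<and> R \<in> \<Q> \<and> Q \<noteq> R}"
  have "finite {(Q, R). Q \<in> \<Q> \<and> R \<in> \<Q> \<and> Q \<noteq> R}"
    by (rule finite_subset[of _ "\<Q> \<times> \<Q>"]) (auto simp: assms(2))
  then have "finite E"
    by (simp add: E_def)
  have E: "(\<lambda>l. ex Q l - ex R l) \<in> E" if "Q \<in> \<Q>" "R \<in> \<Q>" "Q \<noteq> R" for Q R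
    unfolding E_def using that by (intro image_eqI[of _ _ "(Q, R)"]) auto
  have diff: "theta_monomial_type m r L (\<lambda>l. ex Q l - ex R l) a = Q a - R a" if "Q \<in> \<Q>" "R \<in> \<Q>" for Q R a
    using ex[OF that(1)] ex[OF that(2)] by (metis theta_monomial_type_diff)
  have "theta_monomial_type m r L e \<noteq> (\<lambda>_. 0)" if e: "e \<in> E" for e
  proof -
    obtain Q R where "Q \<in> \<Q>" "R \<in> \<Q>" "Q \<noteq> R" "e = (\<lambda>l. ex Q l - ex R l)"
      using e by (auto simp: E_def)
    moreover from this obtain a where "Q a \<noteq> R a"
      by blast
    ultimately show ?thesis
      using diff by (metis right_minus_eq)
  qed
  from theta_monomial_types_nonzero_int[of E m r L, OF \<open>finite E\<close> this]
  obtain b where b: "\<forall>e\<in>E. theta_monomial_type m r L e (of_int \<circ> b) \<noteq> 0"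
    by blast
  \<comment> \<open>Since Q is quadratic and \<open>polar Q\<close> is linear in its first argument,
    the factor at k b is exp (k^2 p + k s).\<close>
  define p where "p Q = - (8 * of_real pi * \<i> * \<tau> * Q (of_int \<circ> b))" for Q :: "(var \<Rightarrow> complex) \<Rightarrow> complex"
  define s where "s Q = - (4 * of_real pi * \<i> * polar Q (of_int \<circ> b) w)" for Q
  \<comment> \<open>Types are real at integral vectors, so the real part of p depends on \<tau> only
    through Im \<tau>, and distinct values Q(b) give distinct growth rates.\<close>
  have Re_p: "Re (p Q) = 8 * pi * Im \<tau> * Re (Q (of_int \<circ> b))" and "Q (of_int \<circ> b) \<in> \<real>" if "Q \<in> \<Q>" for Q
  proof -
    show "Q (of_int \<circ> b) \<in> \<real>"
      using ex[OF that] theta_monomial_type_real by metis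
    then show "Re (p Q) = 8 * pi * Im \<tau> * Re (Q (of_int \<circ> b))"
      by (auto simp: p_def elim!: Reals_cases)
  qed
  have "inj_on (\<lambda>Q. Re (p Q)) \<Q>"
  proof (rule inj_onI, rule ccontr)
    fix Q R assume QR: "Q \<in> \<Q>" "R \<in> \<Q>" "Re (p Q) = Re (p R)" "Q \<noteq> R"
    then have "Q (of_int \<circ> b) = R (of_int \<circ> b)"
      using Re_p \<open>\<And>Q. Q \<in> \<Q> \<Longrightarrow> Q (of_int \<circ> b) \<in> \<real>\<close> assms(1)
      by (simp add: complex_eq_iff complex_is_Real_iff)
    then show False
      using b E[of Q R] diff[of Q R] QR by force
  qed
  moreover have "(\<Sum>Q\<in>\<Q>. x Q * exp (of_nat k ^ 2 * p Q + of_nat k * s Q)) = 0" for k :: nat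
  proof -
    have "multiplier \<tau> w (\<lambda>v. int k * b v) Q = exp (of_nat k ^ 2 * p Q + of_nat k * s Q)" if "Q \<in> \<Q>" for Q
    proof -
      obtain e where Q: "Q = theta_monomial_type m r L e"
        using assms(3)[OF \<open>Q \<in> \<Q>\<close>] by blast
      have b: "of_int \<circ> (\<lambda>v. int k * b v) = (\<lambda>v. of_nat k * (of_int \<circ> b) v :: complex)"
        by (simp add: fun_eq_iff)
      show ?thesis
        unfolding multiplier_def p_def s_def b Q theta_monomial_type_scale polar_theta_monomial_type_scale
        by (simp add: algebra_simps o_def)
    qed
    then show ?thesis
      using zero[of "\<lambda>v. int k * b v"] by simp
  qed
  ultimately show ?thesis
    by (intro exp_quadratic_independent[OF assms(2)]) auto
qed

section \<open>The torus and the exchange of two variables\<close>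

lemma form_at_transpose:
  assumes "u \<in> vars m r" "v \<in> vars m r"
  shows "form_at m r (l \<circ> Transposition.transpose u v) w = form_at m r l (w \<circ> Transposition.transpose u v)"
proof -
  let ?s = "Transposition.transpose u v"
  have "bij_betw ?s (vars m r) (vars m r)"
    using assms by (intro bij_betwI[where g = ?s]) (auto simp: Transposition.transpose_def)
  from sum.reindex_bij_betw[OF this, of "\<lambda>x. of_int (l x) * w (?s x)"]
  show ?thesis
    by (simp add: form_at_def)
qed

lemma inj_comp_transpose: "inj (\<lambda>l. l \<circ> Transposition.transpose u v)"
  by (rule injI) (metis comp_assoc comp_id transpose_comp_involutory)

lemma theta_sum_transpose:
  assumes uv: "u \<in> vars m r" "v \<in> vars m r" and "theta_sum \<tau> m r L Q F"
  defines "s \<equiv> Transposition.transpose u v"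
  shows "theta_sum \<tau> m r ((\<lambda>l. l \<circ> s) ` L) (\<lambda>a. Q (a \<circ> s)) (\<lambda>w. F (w \<circ> s))"
proof -
  obtain N c e where type: "\<forall>k<(N::nat). theta_monomial_type m r L (e k) = Q"
    and F: "\<forall>w. regular \<tau> m r L w \<longrightarrow> F w = (\<Sum>k<N. c k * theta_monomial \<tau> m r L (e k) w)"
    using assms(3) unfolding theta_sum_def by metis
  define e' where "e' k l = e k (l \<circ> s)" for k l
  have inj: "inj_on (\<lambda>l. l \<circ> s) L"
    unfolding s_def by (rule inj_on_subset[OF inj_comp_transpose]) simp
  have form: "form_at m r (l \<circ> s) w = form_at m r l (w \<circ> s)" for l w
    unfolding s_def by (rule form_at_transpose[OF uv])
  have e': "e' k (l \<circ> s) = e k l" for k l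
    by (simp add: e'_def s_def comp_assoc)
  have "theta_monomial_type m r ((\<lambda>l. l \<circ> s) ` L) (e' k) a = theta_monomial_type m r L (e k) (a \<circ> s)" for k a
    unfolding theta_monomial_type_def sum.reindex[OF inj] by (simp add: form e')
  moreover have "theta_monomial \<tau> m r ((\<lambda>l. l \<circ> s) ` L) (e' k) w = theta_monomial \<tau> m r L (e k) (w \<circ> s)" for k w
    unfolding theta_monomial_def prod.reindex[OF inj] by (simp add: form e')
  moreover have "regular \<tau> m r ((\<lambda>l. l \<circ> s) ` L) w \<longleftrightarrow> regular \<tau> m r L (w \<circ> s)" for w
    by (simp add: regular_def form)
  ultimately show ?thesis
    unfolding theta_sum_def using type F
    by (intro exI[of _ N] exI[of _ c] exI[of _ e']) (auto simp: fun_eq_iff)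
qed

text \<open>Exchanging two coordinates is a continuous involution of the affine space, so the
  preimage of an open dense set is open and dense.\<close>

lemma generic_eq_transpose:
  assumes uv: "u \<in> vars m r" "v \<in> vars m r" and "generic_eq (affine_top m r) F G"
  defines "s \<equiv> Transposition.transpose u v"
  shows "generic_eq (affine_top m r) (\<lambda>w. F (w \<circ> s)) (\<lambda>w. G (w \<circ> s))"
proof -
  let ?T = "affine_top m r"
  have s: "s x \<in> vars m r" if "x \<in> vars m r" for x
    using uv that by (auto simp: s_def Transposition.transpose_def)
  \<comment> \<open>Variables outside the finite set are fixed, which keeps w \<circ> s
    extensional.\<close>
  have s': "s x = x" if "x \<notin> vars m r" for x
    using uv that by (auto simp: s_def Transposition.transpose_def)
  have inv: "(w \<circ> s) \<circ> s = w" for w :: "var \<Rightarrow> complex"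
    by (simp add: s_def comp_assoc)
  have cont: "continuous_map ?T ?T (\<lambda>w. w \<circ> s)"
    unfolding affine_top_def continuous_map_componentwise
    using s s' by (auto simp: extensional_def PiE_def intro: continuous_map_product_projection[where X = "\<lambda>_. euclidean", simplified])
  obtain U where U: "open_dense ?T U" "\<forall>w\<in>U. F w = G w"
    using assms(3) by (auto simp: generic_eq_iff_open_dense)
  have preimage: "openin ?T {w \<in> topspace ?T. w \<circ> s \<in> V}" if "openin ?T V" for V
    using openin_continuous_map_preimage[OF cont that] .
  have "open_dense ?T {w \<in> topspace ?T. w \<circ> s \<in> U}"
    unfolding open_dense_iff
  proof (intro conjI allI impI)
    show "openin ?T {w \<in> topspace ?T. w \<circ> s \<in> U}"
      using U(1) by (intro preimage) (simp add: open_dense_iff)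
    fix V assume V: "openin ?T V \<and> V \<noteq> {}"
    then obtain w where w: "w \<in> V" "w \<in> topspace ?T"
      using openin_subset by blast
    then have "w \<circ> s \<in> topspace ?T"
      using cont continuous_map_image_subset_topspace by blast
    then have "{w \<in> topspace ?T. w \<circ> s \<in> V} \<noteq> {}"
      using w(1) inv by (metis (mono_tags, lifting) empty_Collect_eq)
    then obtain p where p: "p \<in> U" "p \<in> topspace ?T" "p \<circ> s \<in> V"
      using U(1) preimage[of V] V unfolding open_dense_iff by blast
    then have "p \<circ> s \<in> topspace ?T"
      using V openin_subset by blast
    then have "p \<circ> s \<in> {w \<in> topspace ?T. w \<circ> s \<in> U} \<inter> V"
      using p inv by simp
    then show "{w \<in> topspace ?T. w \<circ> s \<in> U} \<inter> V \<noteq> {}"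
      by blast
  qed
  then show ?thesis
    unfolding generic_eq_iff_open_dense using U(2) by blast
qed

section \<open>The exponential covering of the torus\<close>

lemma topspace_torus: "topspace (torus_top m r) = PiE (vars m r) (\<lambda>_. - {0})"
  by (simp add: torus_top_def)

lemma continuous_exp_cover: "continuous_map (affine_top m r) (torus_top m r) (exp_cover m r)"
proof -
  have "continuous_map (affine_top m r) euclidean (\<lambda>w. exp (2 * of_real pi * \<i> * w v))" if "v \<in> vars m r" for v
  proof -
    have "continuous_map (affine_top m r) euclidean (\<lambda>w. w v)"
      using that continuous_map_product_projection[of v "vars m r" "\<lambda>_. euclidean"] by (simp add: affine_top_def)
    moreover have "continuous_map euclidean euclidean (\<lambda>x::complex. exp (2 * of_real pi * \<i> * x))"
      by (auto intro!: continuous_intros)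
    ultimately show ?thesis
      using continuous_map_compose[of "affine_top m r" euclidean "\<lambda>w. w v" euclidean
          "\<lambda>x. exp (2 * of_real pi * \<i> * x)"] by (simp add: o_def)
  qed
  then show ?thesis
    unfolding torus_top_def continuous_map_componentwise
    by (auto simp: exp_cover_def continuous_map_in_subtopology)
qed

lemma exp_cover_surj:
  assumes "z \<in> topspace (torus_top m r)"
  obtains w where "w \<in> topspace (affine_top m r)" "exp_cover m r w = z"
proof -
  define w where "w = restrict (\<lambda>v. Ln (z v) / (2 * of_real pi * \<i>)) (vars m r)"
  have "exp_cover m r w v = z v" for v
    using assms by (auto simp: exp_cover_def w_def topspace_torus PiE_def extensional_def Pi_def restrict_def)
  then show thesis
    using that[of w] by (auto simp: w_def)
qed

lemma open_exp_2pi_i: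
  assumes "open (S :: complex set)"
  shows "open ((\<lambda>x. exp (2 * of_real pi * \<i> * x)) ` S)"
proof (rule open_mapping_thm[of _ UNIV])
  show "\<not> (\<lambda>x. exp (2 * of_real pi * \<i> * x)) constant_on (UNIV :: complex set)"
  proof
    assume "(\<lambda>x. exp (2 * of_real pi * \<i> * x)) constant_on (UNIV :: complex set)"
    then have "exp (2 * of_real pi * \<i> * (1 / 2)) = exp (2 * of_real pi * \<i> * (0 :: complex))"
      unfolding constant_on_def by (metis UNIV_I)
    then show False
      by (simp add: mult.commute)
  qed
qed (auto intro!: holomorphic_intros assms)

text \<open>The covering acts coordinatewise, so it maps a basic box onto the product of the images
  of its sides, which are open by the open mapping theorem in one variable.\<close>

lemma open_map_exp_cover:
  assumes "openin (affine_top m r) U"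
  shows "openin (torus_top m r) (exp_cover m r ` U)"
  unfolding torus_top_def openin_product_topology_alt
proof (rule ballI)
  let ?e = "\<lambda>x::complex. exp (2 * of_real pi * \<i> * x)"
  fix z assume "z \<in> exp_cover m r ` U"
  then obtain w where w: "w \<in> U" "z = exp_cover m r w"
    by blast
  obtain B where B: "\<And>v. v \<in> vars m r \<Longrightarrow> open (B v)" "w \<in> PiE (vars m r) B" "PiE (vars m r) B \<subseteq> U"
    using assms[unfolded affine_top_def openin_product_topology_alt, rule_format, OF w(1)] by auto
  have "openin (top_of_set (- {0})) (?e ` B v)" if "v \<in> vars m r" for v
    using open_exp_2pi_i[OF B(1)[OF that]] by (intro open_openin_trans) auto
  moreover have "z \<in> PiE (vars m r) (\<lambda>v. ?e ` B v)"
    using B(2) w(2) by (auto simp: exp_cover_def)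
  moreover have "PiE (vars m r) (\<lambda>v. ?e ` B v) \<subseteq> exp_cover m r ` U"
  proof
    fix y assume y: "y \<in> PiE (vars m r) (\<lambda>v. ?e ` B v)"
    then have "\<forall>v\<in>vars m r. \<exists>x\<in>B v. y v = ?e x"
      by (auto simp: PiE_def Pi_def)
    then obtain g where g: "\<And>v. v \<in> vars m r \<Longrightarrow> g v \<in> B v \<and> y v = ?e (g v)"
      by metis
    have "exp_cover m r (restrict g (vars m r)) = y"
      using y g by (auto simp: exp_cover_def fun_eq_iff PiE_def extensional_def restrict_def)
    moreover have "restrict g (vars m r) \<in> U"
      using g B(3) by (metis restrict_PiE_iff subsetD)
    ultimately show "y \<in> exp_cover m r ` U"
      by blast
  qed
  ultimately show "\<exists>B. finite {v \<in> vars m r. B v \<noteq> topspace (top_of_set (- {0}))} \<and>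
      (\<forall>v\<in>vars m r. openin (top_of_set (- {0})) (B v)) \<and> z \<in> PiE (vars m r) B \<and> PiE (vars m r) B \<subseteq> exp_cover m r ` U"
    by (intro exI[of _ "\<lambda>v. ?e ` B v"]) auto
qed

text \<open>The covering is a continuous open surjection and so maps open dense sets to open dense
  sets. This carries the nonvanishing of f from the torus to the cover, where the theta sums
  live.\<close>

lemma generic_eq_torusI:
  assumes "generic_eq (affine_top m r) (\<lambda>w. f (exp_cover m r w)) (\<lambda>w. g (exp_cover m r w))"
  shows "generic_eq (torus_top m r) f g"
proof -
  obtain U where U: "open_dense (affine_top m r) U" "\<forall>w\<in>U. f (exp_cover m r w) = g (exp_cover m r w)"
    using assms unfolding generic_eq_iff_open_dense by blast
  have "open_dense (torus_top m r) (exp_cover m r ` U)"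
    unfolding open_dense_iff
  proof (intro conjI allI impI)
    show "openin (torus_top m r) (exp_cover m r ` U)"
      using U(1) by (intro open_map_exp_cover) (simp add: open_dense_iff)
    fix V assume V: "openin (torus_top m r) V \<and> V \<noteq> {}"
    then obtain z where z: "z \<in> V" "z \<in> topspace (torus_top m r)"
      using openin_subset by blast
    then have "{w \<in> topspace (affine_top m r). exp_cover m r w \<in> V} \<noteq> {}"
      using exp_cover_surj[OF z(2)] by blast
    moreover have "openin (affine_top m r) {w \<in> topspace (affine_top m r). exp_cover m r w \<in> V}"
      using openin_continuous_map_preimage[OF continuous_exp_cover] V by blast
    ultimately show "exp_cover m r ` U \<inter> V \<noteq> {}"
      using U(1) unfolding open_dense_iff by blast
  qed
  then show ?thesis
    unfolding generic_eq_iff_open_dense using U(2) by blast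
qed

lemma monomial_at_exp_cover: "monomial_at m r l (exp_cover m r w) = exp (2 * of_real pi * \<i> * form_at m r l w)"
proof -
  have "monomial_at m r l (exp_cover m r w) = (\<Prod>v\<in>vars m r. exp (of_int (l v) * (2 * of_real pi * \<i> * w v)))"
    unfolding monomial_at_def exp_cover_def by (intro prod.cong) (simp_all add: exp_power_int)
  then show ?thesis
    by (simp add: form_at_def sum_distrib_left mult_ac flip: exp_sum)
qed

lemma exp_cover_transpose:
  assumes "u \<in> vars m r" "v \<in> vars m r"
  shows "exp_cover m r w \<circ> Transposition.transpose u v = exp_cover m r (w \<circ> Transposition.transpose u v)"
  using assms by (auto simp: exp_cover_def fun_eq_iff restrict_def Transposition.transpose_def)

lemma kronF_nonzero:
  assumes "Im \<tau> > 0" "theta \<tau> x \<noteq> 0" "theta \<tau> y \<noteq> 0" "theta \<tau> (x + y) \<noteq> 0"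
  shows "kronF \<tau> x y \<noteq> 0"
  using assms deriv_theta_0_nonzero by (simp add: kronF_def)

section \<open>The criterion for purity\<close>

theorem lemma12p1:
  fixes \<tau> :: complex and m r i :: nat
    and f Q :: "(var \<Rightarrow> complex) \<Rightarrow> complex" and \<mu> :: "var \<Rightarrow> int"
  assumes "Im \<tau> > 0"
    and "f \<in> alg_A \<tau> m r"
    and "\<not> generic_eq (torus_top m r) f (\<lambda>_. 0)"
    and "pure_of_type \<tau> m r f Q"
    and "i \<in> {1..m - 1}"
    and "\<mu> \<in> forms (muvars r)"
  shows "pure \<tau> m r (C_op \<tau> m r i \<mu> f) \<longleftrightarrow>
    (\<forall>a. a (X i) \<noteq> a (X (Suc i)) \<longrightarrow> form_at m r \<mu> a = divided_diff i Q a - a (Mu 0))"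
proof -
  note \<tau> = assms(1)
  define x y h where "x = X i" and "y = X (Suc i)" and "h = Mu 0"
  define s where "s = Transposition.transpose x y"
  have vars: "x \<in> vars m r" "y \<in> vars m r" "h \<in> vars m r"
    using assms(5) by (auto simp: x_def y_def h_def vars_def xvars_def muvars_def)
  have neq: "x \<noteq> y" "x \<noteq> h" "y \<noteq> h"
    by (simp_all add: x_def y_def h_def)
  obtain L0 F where L0: "finite L0" "L0 \<subseteq> forms (vars m r)" and F: "theta_sum \<tau> m r L0 Q F"
    and fF: "generic_eq (affine_top m r) (\<lambda>w. f (exp_cover m r w)) F"
    using assms(4) unfolding pure_of_type_iff_theta_sum[OF \<tau>] by blast
  define xi where "xi = (\<lambda>v. unit_form y v + - unit_form x v)"
  define xi' where "xi' = (\<lambda>v. unit_form x v + - unit_form y v)"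
  have xi: "form_at m r xi w = w y - w x" and xi': "form_at m r xi' w = w x - w y"
    and eta: "form_at m r (unit_form h) w = w h" for w
    by (simp_all only: xi_def xi'_def form_at_add form_at_uminus form_at_unit vars) simp_all
  \<comment> \<open>The theta arguments of the two coefficients of \<open>C_op\<close>, as triples
    l1, l2, l1 + l2. Regularity for S also makes both coefficients nonzero.\<close>
  define S where "S = {xi, \<mu>, (\<lambda>v. xi v + \<mu> v), xi', unit_form h, (\<lambda>v. xi' v + unit_form h v)}"
  have \<mu>0: "\<mu> x = 0" "\<mu> y = 0" "\<mu> \<noteq> (\<lambda>_. 0)" "\<And>v. v \<notin> vars m r \<Longrightarrow> \<mu> v = 0"
    using assms(6) by (auto simp: forms_def x_def y_def muvars_def vars_def)
  have S: "finite S" "S \<subseteq> forms (vars m r)"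
  proof -
    \<comment> \<open>Every form of S except \<open>\<mu>\<close> and \<open>unit_form h\<close> is
      nontrivial already at x, because \<open>\<mu>\<close> and \<open>unit_form h\<close> do not
      involve x.\<close>
    have at_x: "xi x = - 1" "xi' x = 1" "xi x + \<mu> x = - 1" "xi' x + unit_form h x = 1" "unit_form h h = 1"
      using neq \<mu>0 by (simp_all add: xi_def xi'_def unit_form_def)
    have "xi \<noteq> (\<lambda>_. 0)" "xi' \<noteq> (\<lambda>_. 0)" "(\<lambda>v. xi v + \<mu> v) \<noteq> (\<lambda>_. 0)"
        "(\<lambda>v. xi' v + unit_form h v) \<noteq> (\<lambda>_. 0)" "unit_form h \<noteq> (\<lambda>_. 0)"
      using at_x by (auto dest: fun_cong[of _ _ x] fun_cong[of _ _ h])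
    moreover have "xi v = 0" "xi' v = 0" "unit_form h v = 0" if "v \<notin> vars m r" for v
      using that vars by (auto simp: xi_def xi'_def unit_form_def)
    ultimately show "S \<subseteq> forms (vars m r)"
      using \<mu>0 by (auto simp: S_def forms_def)
  qed (simp add: S_def)
  define L0' where "L0' = (\<lambda>l. l \<circ> s) ` L0"
  define L1 where "L1 = L0 \<union> L0' \<union> S"
  have L0': "finite L0'" "L0' \<subseteq> forms (vars m r)"
  proof -
    have "l \<circ> s \<in> forms (vars m r)" if "l \<in> forms (vars m r)" for l
    proof -
      have "l (s v) = 0" if "v \<notin> vars m r" for v
        using that vars \<open>l \<in> forms (vars m r)\<close> by (auto simp: forms_def s_def Transposition.transpose_def)
      moreover obtain v where "l v \<noteq> 0"
        using \<open>l \<in> forms (vars m r)\<close> by (auto simp: forms_def fun_eq_iff)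
      then have "(l \<circ> s) (s v) \<noteq> 0"
        by (simp add: s_def)
      then have "l \<circ> s \<noteq> (\<lambda>_. 0)"
        by metis
      ultimately show ?thesis
        by (simp add: forms_def)
    qed
    then show "L0' \<subseteq> forms (vars m r)"
      using L0(2) by (auto simp: L0'_def)
  qed (simp add: L0'_def L0)
  have L1: "finite L1" "L1 \<subseteq> forms (vars m r)"
    using L0 L0' S by (auto simp: L1_def)
  define F' where "F' = (\<lambda>w. F (w \<circ> s))"
  define A where "A w = kronF \<tau> (form_at m r xi w) (form_at m r \<mu> w) * F w" for w
  define B where "B w = kronF \<tau> (form_at m r xi' w) (form_at m r (unit_form h) w) * F' w" for w
  define QA where "QA = (\<lambda>a. Q a + form_at m r xi a * form_at m r \<mu> a)"
  define QB where "QB = (\<lambda>a. Q (a \<circ> s) + form_at m r xi' a * form_at m r (unit_form h) a)"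
  have F1: "theta_sum \<tau> m r L1 Q F"
    by (rule theta_sum_mono[OF F]) (use L1 in \<open>auto simp: L1_def\<close>)
  have "theta_sum \<tau> m r L0' (\<lambda>a. Q (a \<circ> s)) F'"
    unfolding L0'_def F'_def s_def by (rule theta_sum_transpose[OF vars(1,2) F])
  then have F1': "theta_sum \<tau> m r L1 (\<lambda>a. Q (a \<circ> s)) F'"
    by (rule theta_sum_mono) (use L1 in \<open>auto simp: L1_def\<close>)
  have A: "theta_sum \<tau> m r L1 QA A"
    unfolding QA_def A_def [abs_def] by (rule theta_sum_kronF[OF F1 L1(1)]) (simp_all add: L1_def S_def)
  have B: "theta_sum \<tau> m r L1 QB B"
    unfolding QB_def B_def [abs_def] by (rule theta_sum_kronF[OF F1' L1(1)]) (simp_all add: L1_def S_def)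
  have fF': "generic_eq (affine_top m r) (\<lambda>w. f (exp_cover m r (w \<circ> s))) F'"
    unfolding F'_def s_def by (rule generic_eq_transpose[OF vars(1,2) fF])
  have C_op: "C_op \<tau> m r i \<mu> f (exp_cover m r w) =
      kronF \<tau> (form_at m r xi w) (form_at m r \<mu> w) * f (exp_cover m r w) +
      kronF \<tau> (form_at m r xi' w) (form_at m r (unit_form h) w) * f (exp_cover m r (w \<circ> s))" for w
  proof -
    have at: "exp_cover m r w v = exp (2 * of_real pi * \<i> * w v)" if "v \<in> vars m r" for v
      using that by (simp add: exp_cover_def)
    have quot: "exp_cover m r w u / exp_cover m r w v = exp (2 * of_real pi * \<i> * (w u - w v))"
      if "u \<in> vars m r" "v \<in> vars m r" for u v
      using that by (simp add: at right_diff_distrib exp_diff)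
    show ?thesis
      unfolding C_op_def swap_vars_def x_def[symmetric] y_def[symmetric] h_def[symmetric]
        monomial_at_exp_cover s_def[symmetric] exp_cover_transpose[OF vars(1,2), folded s_def] xi xi' eta
        quot[OF vars(1,2)] quot[OF vars(2,1)] at[OF vars(3)] delta_exp
      by (rule refl)
  qed
  have CAB: "generic_eq (affine_top m r) (\<lambda>w. C_op \<tau> m r i \<mu> f (exp_cover m r w)) (\<lambda>w. A w + B w)"
  proof -
    obtain U U' where "open_dense (affine_top m r) U" "\<forall>w\<in>U. f (exp_cover m r w) = F w"
      "open_dense (affine_top m r) U'" "\<forall>w\<in>U'. f (exp_cover m r (w \<circ> s)) = F' w"
      using fF fF' unfolding generic_eq_iff_open_dense by blast
    then show ?thesis
      unfolding generic_eq_iff_open_dense C_op A_def B_def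
      by (intro exI[of _ "U \<inter> U'"]) (simp add: open_dense_Int)
  qed
  \<comment> \<open>Multiplying the criterion by a x - a y gives QA a = QB a. Where a x = a y, the
    exchange fixes a and both coefficients x - y vanish, so QA and QB agree there
    automatically.\<close>
  have types: "QA = QB \<longleftrightarrow>
    (\<forall>a. a (X i) \<noteq> a (X (Suc i)) \<longrightarrow> form_at m r \<mu> a = divided_diff i Q a - a (Mu 0))"
  proof -
    have "QA a = QB a \<longleftrightarrow> (a x \<noteq> a y \<longrightarrow> form_at m r \<mu> a = divided_diff i Q a - a h)" for a
    proof (cases "a x = a y")
      case True
      then have "a \<circ> s = a"
        by (auto simp: s_def Transposition.transpose_def fun_eq_iff)
      then show ?thesis
        using True by (simp add: QA_def QB_def xi xi')
    next
      case False
      then show ?thesis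
        unfolding QA_def QB_def xi xi' eta divided_diff_def swap_vars_def
          x_def[symmetric] y_def[symmetric] s_def[symmetric]
        by (simp add: field_simps) (auto simp: algebra_simps)
    qed
    then show ?thesis
      unfolding fun_eq_iff x_def y_def h_def by blast
  qed
  have "pure \<tau> m r (C_op \<tau> m r i \<mu> f)" if "QA = QB"
    unfolding pure_def pure_of_type_iff_theta_sum[OF \<tau>]
    using theta_sum_add[OF A B[folded that]] L1 CAB by blast
  moreover have "QA = QB" if "pure \<tau> m r (C_op \<tau> m r i \<mu> f)"
  proof (rule ccontr)
    assume "QA \<noteq> QB"
    obtain P L2 C where L2: "finite L2" "L2 \<subseteq> forms (vars m r)" and C: "theta_sum \<tau> m r L2 P C"
      and fC: "generic_eq (affine_top m r) (\<lambda>w. C_op \<tau> m r i \<mu> f (exp_cover m r w)) C"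
      using \<open>pure \<tau> m r (C_op \<tau> m r i \<mu> f)\<close> unfolding pure_def pure_of_type_iff_theta_sum[OF \<tau>] by blast
    define L where "L = L1 \<union> L2"
    have L: "finite L" "L \<subseteq> forms (vars m r)"
      using L1 L2 by (auto simp: L_def)
    have A: "theta_sum \<tau> m r L QA A" and B: "theta_sum \<tau> m r L QB B" and C: "theta_sum \<tau> m r L P C"
      and F: "theta_sum \<tau> m r L Q F" and F': "theta_sum \<tau> m r L (\<lambda>a. Q (a \<circ> s)) F'"
      by (rule theta_sum_mono[OF A] theta_sum_mono[OF B] theta_sum_mono[OF C]
          theta_sum_mono[OF F1] theta_sum_mono[OF F1']; use L in \<open>auto simp: L_def\<close>)+
    \<comment> \<open>Nonvanishing descends to F through the covering, and passes to F' because the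
      exchange is an involution.\<close>
    have "\<not> generic_eq (affine_top m r) F (\<lambda>_. 0)"
      using assms(3) generic_eq_torusI[of m r f "\<lambda>_. 0"] generic_eq_trans[OF fF] by blast
    moreover have "generic_eq (affine_top m r) F (\<lambda>_. 0)" if "generic_eq (affine_top m r) F' (\<lambda>_. 0)"
      using generic_eq_transpose[OF vars(1,2) that] by (simp add: F'_def comp_assoc s_def)
    ultimately have nz: "\<not> generic_eq (affine_top m r) F (\<lambda>_. 0)" "\<not> generic_eq (affine_top m r) F' (\<lambda>_. 0)"
      by blast+
    have "open_dense (affine_top m r) ({w \<in> topspace (affine_top m r). regular \<tau> m r L w \<and> F w \<noteq> 0} \<inter>
        {w \<in> topspace (affine_top m r). regular \<tau> m r L w \<and> F' w \<noteq> 0})"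
      using nz by (intro open_dense_Int clearable_not_generic_zero \<tau> L clearable_theta_sum[OF \<tau> F L(1)]
          clearable_theta_sum[OF \<tau> F' L(1)])
    then obtain w where w: "regular \<tau> m r L w" "F w \<noteq> 0" "F' w \<noteq> 0"
      by (rule open_dense_affine_nonempty) blast
    have S_w: "theta \<tau> (form_at m r l w) \<noteq> 0" if "l \<in> S" for l
      using w(1) that by (simp add: regular_def L_def L1_def)
    have "A w \<noteq> 0"
      using w(2) kronF_nonzero[OF \<tau>, of "form_at m r xi w" "form_at m r \<mu> w"]
        S_w[of xi] S_w[of \<mu>] S_w[of "\<lambda>v. xi v + \<mu> v"] by (simp add: A_def S_def form_at_add)
    have "B w \<noteq> 0"
      using w(3) kronF_nonzero[OF \<tau>, of "form_at m r xi' w" "form_at m r (unit_form h) w"]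
        S_w[of xi'] S_w[of "unit_form h"] S_w[of "\<lambda>v. xi' v + unit_form h v"]
      by (simp add: B_def S_def form_at_add)
    \<comment> \<open>The generic identity is upgraded to all regular points, since it will be used
      at each shift of w.\<close>
    have ABC: "A w' + B w' = C w'" if "regular \<tau> m r L w'" for w'
    proof -
      have "clearable \<tau> m r L (\<lambda>w. A w + B w + (- 1) * C w)"
        by (intro clearable_add \<tau> clearable_theta_sum[OF \<tau> A L(1)] clearable_theta_sum[OF \<tau> B L(1)]
            clearable_theta_sum[OF \<tau> theta_sum_cmult[OF C] L(1)])
      moreover have "generic_eq (affine_top m r) (\<lambda>w. A w + B w + (- 1) * C w) (\<lambda>_. 0)"
        using generic_eq_trans[OF generic_eq_sym[OF CAB] fC] by (simp add: generic_eq_def)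
      ultimately show ?thesis
        using clearable_generic_zero[OF \<tau> L _ _ that] by force
    qed
    \<comment> \<open>If C vanishes at w it vanishes at all shifts of w, and P may be no quadratic
      form at all. A term with coefficient 0 may carry any type, so \<open>QA\<close> is put in its
      place.\<close>
    define P' where "P' = (if C w = 0 then QA else P)"
    \<comment> \<open>The three types may coincide, so the coefficients are collected per
      type.\<close>
    define c where "c R = (if R = QA then A w else 0) + (if R = QB then B w else 0) - (if R = P' then C w else 0)" for R
    have "\<forall>R\<in>{QA, QB, P'}. c R = 0"
    proof (rule multiplier_independent[OF \<tau>])
      fix R assume R: "R \<in> {QA, QB, P'}"
      obtain eA where eA: "QA = theta_monomial_type m r L eA"
        using theta_sum_nonzero_type[OF A w(1) \<open>A w \<noteq> 0\<close>] .
      obtain eB where eB: "QB = theta_monomial_type m r L eB"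
        using theta_sum_nonzero_type[OF B w(1) \<open>B w \<noteq> 0\<close>] .
      have "\<exists>e. P' = theta_monomial_type m r L e"
      proof (cases "C w = 0")
        case True
        then show ?thesis
          using eA by (auto simp: P'_def)
      next
        case False
        then obtain e where "P = theta_monomial_type m r L e"
          by (rule theta_sum_nonzero_type[OF C w(1)])
        then show ?thesis
          using False by (auto simp: P'_def)
      qed
      then show "\<exists>e. R = theta_monomial_type m r L e"
        using R eA eB by blast
    next
      fix b
      have "C (shift \<tau> b w) = multiplier \<tau> w b P' * C w"
        using theta_sum_shift[OF \<tau> C w(1), of b] by (auto simp: P'_def)
      then have "A w * multiplier \<tau> w b QA + B w * multiplier \<tau> w b QB - C w * multiplier \<tau> w b P' = 0"
        using ABC[OF regular_shift[OF \<tau> w(1)], of b] theta_sum_shift[OF \<tau> A w(1), of b]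
          theta_sum_shift[OF \<tau> B w(1), of b] by (simp add: mult.commute)
      moreover have delta: "(\<Sum>R\<in>{QA, QB, P'}. (if R = R0 then z else 0) * multiplier \<tau> w b R) = z * multiplier \<tau> w b R0"
        if "R0 \<in> {QA, QB, P'}" for R0 and z :: complex
      proof -
        have "(\<Sum>R\<in>{QA, QB, P'}. (if R = R0 then z else 0) * multiplier \<tau> w b R) =
            (\<Sum>R\<in>{QA, QB, P'}. if R = R0 then z * multiplier \<tau> w b R0 else 0)"
          by (intro sum.cong) auto
        then show ?thesis
          unfolding sum.delta[OF finite.insertI[OF finite.insertI[OF finite.insertI[OF finite.emptyI]]]] using that by simp
      qed
      ultimately show "(\<Sum>R\<in>{QA, QB, P'}. c R * multiplier \<tau> w b R) = 0"
        unfolding c_def ring_distribs sum.distrib sum_subtractf by (subst (1 2 3) delta) auto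
    qed simp
    \<comment> \<open>As \<open>QA\<close> and \<open>QB\<close> differ, P' misses one of them, and
      the coefficient there is the nonzero A w or B w.\<close>
    then have "c QA = 0" "c QB = 0"
      by simp_all
    then show False
      using \<open>QA \<noteq> QB\<close> \<open>A w \<noteq> 0\<close> \<open>B w \<noteq> 0\<close> by (auto simp: c_def split: if_splits)
  qed
  ultimately show ?thesis
    using types by blast
qed

end
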